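(* Let $N$ be a completely solvable Nakamura manifold, and let $Y_t=(N,g_t,J_t)$, $t\in\mathbb{R}^4$ with $|t|^2<\varepsilon$ ($\varepsilon>0$ sufficiently small), be the family of almost Kähler structures on $N$ defined by $J_t=(I+L_t)J(I+L_t)^{-1}$ and $g_t(\cdot,\cdot)=\omega(\cdot,J_t\cdot)$, as specified in the context. For every value of the parameter $t$, the canonical connection $\nabla^c$ on $Y_t$ is Ricci-flat, i.e. $\mathrm{Ric}(\nabla^c)\equiv0$; in particular its scalar curvature $\mathrm{scal}(\nabla^c)$ vanishes.
   Context: **Nakamura manifold.** Let $A\in SL(2,\mathbb{Z})$ have distinct positive real eigenvalues $e^{-\zeta},e^{\zeta}$, $\zeta\ne0$; let $\Lambda=\mathrm{diag}(e^{-\zeta},e^{\zeta})=PAP^{-1}$ with $P$ a real invertible $2\times2$ matrix. Let $\Gamma=P\mathbb{Z}^2\oplus iP\mathbb{Z}^2\subset\mathbb{C}^2$ and $\mathbb{T}^2_{\mathbb{C}}=\mathbb{C}^2/\Gamma$, with coordinates $z^1=y^1+iy^3$, $z^2=y^2+iy^4$. Let $T_1(s,[z])=(s+\zeta,[\Lambda z])$ on $\mathbb{R}\times\mathbb{T}^2_{\mathbb{C}}$, and $N=\mathbb{S}^1\times(\mathbb{R}\times\mathbb{T}^2_{\mathbb{C}})/\langle T_1\rangle$, with $x$ the coordinate on $\mathbb{S}^1$. A global coframe on $N$ is $E^1=ds$, $E^2=dx$, $E^3=e^{s}dy^1$, $E^4=e^{-s}dy^2$, $E^5=e^{s}dy^3$,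 $E^6=e^{-s}dy^4$; $\{E_1,\dots,E_6\}$ is the dual frame. **The structures.** $J$ is the almost complex structure on $N$ with $JE_1=E_2$, $JE_3=E_4$, $JE_5=E_6$. The symplectic form is $\omega=E^1\wedge E^2+E^3\wedge E^4+E^5\wedge E^6$. For $t\in\mathbb{R}^4$, $L_t$ is the endomorphism of $TN$ with $L_tE_1=-t_1E_1-t_2E_2$, $L_tE_2=-t_2E_1+t_1E_2$, $L_tE_3=E_3$, $L_tE_4=E_4$, $L_tE_5=-t_3E_5-t_4E_6$, $L_tE_6=-t_4E_5+t_3E_6$; for small $\varepsilon$, $I+L_t$ is invertible when $|t|^2<\varepsilon$. **Canonical connection.** For an almost Kähler manifold $(M,g,J)$ with Levi-Civita connection $\nabla^{LC}$, the canonical connection is $\nabla^c_XY=\frac12\left(\nabla^{LC}_XY-J\nabla^{LC}_X(JY)\right)$ on $TM$; it satisfies $\nabla^cg=0$, $\nabla^cJ=0$, and is extended complex-linearly, so that it restricts to a connection on $T^{1,0}M$. **Ricci and scalar curvature.** Let $\{z_1,\dots,z_n\}$ be a local frame of $T^{1,0}M$ unitary for $h(Z,W)=g_{\mathbb{C}}(Z,\bar W)$ ($g_{\mathbb C}$ the complex bilinear extension of $g$), with dual coframe $\{\Phi^1,\dots,\Phi^n\}$. The connection forms are defined by $\nabla^cz_j=\sum_i\theta^i_j\otimes z_i$, and the curvature forms by $\Psi^i_j=d\theta^i_j+\sum_k\theta^i_k\wedge\theta^k_j$. Write the $(1,1)$-part as $(\Psi^i_j)^{1,1}=\sum_{k,l}R^i_{jk\bar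 l}\,\Phi^k\wedge\bar\Phi^l$. Then $\mathrm{Ric}(\nabla^c)=\sum_{k,l}R_{k\bar l}\,\Phi^k\wedge\bar\Phi^l$ with $R_{k\bar l}=\sum_iR^i_{ik\bar l}$, and $\mathrm{scal}(\nabla^c)=\sum_kR_{k\bar k}$. *)

theory Defs
  imports "HOL-Analysis.Analysis" "HOL-Library.Numeral_Type"
begin

section \<open>Tensor calculus on an open subset of a coordinate space\<close>

text \<open>
  Tangent vectors of \<open>real^'m\<close> are elements of \<open>real^'m\<close>, complexified tangent vectors are elements
  of \<open>complex^'m\<close>.  A field is a function of the base point, which is always the first argument of a
  tensor.
\<close>

type_synonym 'm vfield = "real^'m \<Rightarrow> real^'m"
type_synonym 'm cvfield = "real^'m \<Rightarrow> complex^'m"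
type_synonym 'm tensor2 = "real^'m \<Rightarrow> real^'m \<Rightarrow> real^'m \<Rightarrow> real"
type_synonym 'm endo = "real^'m \<Rightarrow> real^'m \<Rightarrow> real^'m"
type_synonym 'm cform1 = "real^'m \<Rightarrow> complex^'m \<Rightarrow> complex"
type_synonym 'm cform2 = "real^'m \<Rightarrow> complex^'m \<Rightarrow> complex^'m \<Rightarrow> complex"

text \<open>\<open>Ck k f W\<close>: all iterated directional derivatives of order at most \<open>k\<close> exist and are
  differentiable or, at order \<open>k\<close>, continuous (for open \<open>W\<close> in finite dimension: class \<open>C^k\<close>).\<close>

primrec Ck :: "nat \<Rightarrow> ('a::real_normed_vector \<Rightarrow> 'b::real_normed_vector) \<Rightarrow> 'a set \<Rightarrow> bool" where
  "Ck 0 f W \<longleftrightarrow> continuous_on W f"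
| "Ck (Suc k) f W \<longleftrightarrow>
     (\<forall>x\<in>W. f differentiable (at x)) \<and> (\<forall>v. Ck k (\<lambda>x. frechet_derivative f (at x) v) W)"

definition smooth_on :: "'a::real_normed_vector set \<Rightarrow> ('a \<Rightarrow> 'b::real_normed_vector) \<Rightarrow> bool" where
  "smooth_on W f \<longleftrightarrow> (\<forall>k. Ck k f W)"


subsection \<open>Complexification\<close>

definition reV :: "complex^'m::finite \<Rightarrow> real^'m" where "reV w = (\<chi> a. Re (w $ a))"
definition imV :: "complex^'m::finite \<Rightarrow> real^'m" where "imV w = (\<chi> a. Im (w $ a))"
definition cxV :: "real^'m::finite \<Rightarrow> real^'m \<Rightarrow> complex^'m" where "cxV u v = (\<chi> a. Complex (u $ a) (v $ a))"
definition cnjV :: "complex^'m::finite \<Rightarrow> complex^'m" where "cnjV w = (\<chi> a. cnj (w $ a))"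

text \<open>Complex-linear extension of a real linear map, and complex-bilinear extension of a real
  bilinear form.\<close>

definition ext_lin :: "(real^'m::finite \<Rightarrow> real^'m) \<Rightarrow> complex^'m \<Rightarrow> complex^'m" where
  "ext_lin L w = cxV (L (reV w)) (L (imV w))"

definition ext_bil :: "(real^'m::finite \<Rightarrow> real^'m \<Rightarrow> real) \<Rightarrow> complex^'m \<Rightarrow> complex^'m \<Rightarrow> complex" where
  "ext_bil b w w' = Complex (b (reV w) (reV w') - b (imV w) (imV w'))
                            (b (reV w) (imV w') + b (imV w) (reV w'))"

definition cdir_deriv :: "(real^'m::finite \<Rightarrow> complex) \<Rightarrow> real^'m \<Rightarrow> complex^'m \<Rightarrow> complex" where
  "cdir_deriv f p w =
     frechet_derivative f (at p) (reV w) + \<i> * frechet_derivative f (at p) (imV w)"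


subsection \<open>Exterior calculus\<close>

definition wedge :: "('v \<Rightarrow> 'c::comm_ring_1) \<Rightarrow> ('v \<Rightarrow> 'c) \<Rightarrow> 'v \<Rightarrow> 'v \<Rightarrow> 'c" where
  "wedge \<alpha> \<beta> u v = \<alpha> u * \<beta> v - \<alpha> v * \<beta> u"

text \<open>Exterior derivative of a complex-valued 1-form and of a real 2-form, evaluated on constant
  coordinate vector fields, so that the bracket terms drop out.\<close>

definition ext_d1 :: "'m::finite cform1 \<Rightarrow> 'm cform2" where
  "ext_d1 \<alpha> p u v = cdir_deriv (\<lambda>q. \<alpha> q v) p u - cdir_deriv (\<lambda>q. \<alpha> q u) p v"

definition ext_d2 :: "'m::finite tensor2 \<Rightarrow> real^'m \<Rightarrow> real^'m \<Rightarrow> real^'m \<Rightarrow> real^'m \<Rightarrow> real" where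
  "ext_d2 \<Omega> p u v w =
       frechet_derivative (\<lambda>q. \<Omega> q v w) (at p) u
     - frechet_derivative (\<lambda>q. \<Omega> q u w) (at p) v
     + frechet_derivative (\<lambda>q. \<Omega> q u v) (at p) w"


subsection \<open>Almost Kaehler structures\<close>

definition riemannian_metric :: "(real^'m::finite) set \<Rightarrow> 'm tensor2 \<Rightarrow> bool" where
  "riemannian_metric W g \<longleftrightarrow>
     (\<forall>p\<in>W. bilinear (g p) \<and> (\<forall>u v. g p u v = g p v u) \<and> (\<forall>v. v \<noteq> 0 \<longrightarrow> 0 < g p v v)) \<and>
     (\<forall>u v. smooth_on W (\<lambda>p. g p u v))"

definition almost_complex :: "(real^'m::finite) set \<Rightarrow> 'm endo \<Rightarrow> bool" where
  "almost_complex W J \<longleftrightarrow>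
     (\<forall>p\<in>W. linear (J p) \<and> (\<forall>v. J p (J p v) = - v)) \<and> (\<forall>v. smooth_on W (\<lambda>p. J p v))"

definition almost_kaehler :: "(real^'m::finite) set \<Rightarrow> 'm tensor2 \<Rightarrow> 'm endo \<Rightarrow> bool" where
  "almost_kaehler W g J \<longleftrightarrow>
     riemannian_metric W g \<and> almost_complex W J \<and>
     (\<forall>p\<in>W. \<forall>u v. g p (J p u) (J p v) = g p u v) \<and>
     (\<forall>p\<in>W. \<forall>u v w. ext_d2 (\<lambda>q a b. g q (J q a) b) p u v w = 0)"


subsection \<open>The Levi-Civita and the canonical connection\<close>

definition metric_matrix :: "'m::finite tensor2 \<Rightarrow> real^'m \<Rightarrow> real^'m^'m" where
  "metric_matrix g p = (\<chi> a b. g p (axis a 1) (axis b 1))"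

definition pderiv_metric :: "'m::finite tensor2 \<Rightarrow> real^'m \<Rightarrow> 'm \<Rightarrow> 'm \<Rightarrow> 'm \<Rightarrow> real" where
  "pderiv_metric g p a b c =
     frechet_derivative (\<lambda>q. metric_matrix g q $ b $ c) (at p) (axis a 1)"

text \<open>\<open>christoffel g p c a b\<close> has upper index \<open>c\<close>.\<close>

definition christoffel :: "'m::finite tensor2 \<Rightarrow> real^'m \<Rightarrow> 'm \<Rightarrow> 'm \<Rightarrow> 'm \<Rightarrow> real" where
  "christoffel g p c a b =
     (1/2) * (\<Sum>e\<in>UNIV. matrix_inv (metric_matrix g p) $ c $ e *
        (pderiv_metric g p a b e + pderiv_metric g p b a e - pderiv_metric g p e a b))"

text \<open>A connection is applied to a base point, a tangent vector at that point (the direction) and a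
  vector field.\<close>

definition levi_civita :: "'m::finite tensor2 \<Rightarrow> real^'m \<Rightarrow> real^'m \<Rightarrow> 'm vfield \<Rightarrow> real^'m" where
  "levi_civita g p x Y = frechet_derivative Y (at p) x +
     (\<chi> c. \<Sum>a\<in>UNIV. \<Sum>b\<in>UNIV. christoffel g p c a b * x $ a * Y p $ b)"

text \<open>This is the torsion-free metric connection: \<open>levi_civita_torsion_free\<close>, \<open>levi_civita_metric\<close>.\<close>

lemma metric_matrix_expand:
  assumes "bilinear (g q)"
  shows "g q u v = (\<Sum>b\<in>UNIV. \<Sum>c\<in>UNIV. metric_matrix g q $ b $ c * u $ b * v $ c)"
proof -
  have l: "linear (g q u)" "linear (\<lambda>u. g q u v)" for u v
    using assms by (auto simp: bilinear_def)
  have "g q u v = g q (\<Sum>b\<in>UNIV. u $ b *s axis b 1) (\<Sum>c\<in>UNIV. v $ c *s axis c 1)"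
    by (simp add: basis_expansion)
  also have "\<dots> = (\<Sum>b\<in>UNIV. \<Sum>c\<in>UNIV. u $ b * (v $ c * g q (axis b 1) (axis c 1)))"
    by (simp add: scalar_mult_eq_scaleR linear_sum[OF l(1)] linear_sum[OF l(2)]
        linear_scale[OF l(1)] linear_scale[OF l(2)] sum_distrib_left)
       (subst sum.swap, simp add: mult_ac)
  finally show ?thesis by (simp add: metric_matrix_def mult_ac)
qed

lemma riemannian_metric_differentiable:
  assumes "riemannian_metric W g" "p \<in> W"
  shows "(\<lambda>q. metric_matrix g q $ b $ c) differentiable (at p)"
proof -
  have "Ck (Suc 0) (\<lambda>q. g q (axis b 1) (axis c 1)) W"
    using assms(1) unfolding riemannian_metric_def smooth_on_def by blast
  then show ?thesis using assms(2) by (simp add: metric_matrix_def)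
qed

lemma pderiv_metric_sym:
  assumes g: "riemannian_metric W g" and W: "open W" "p \<in> W"
  shows "pderiv_metric g p a b c = pderiv_metric g p a c b"
proof -
  have "((\<lambda>q. metric_matrix g q $ b $ c) has_derivative frechet_derivative (\<lambda>q. metric_matrix g q $ b $ c) (at p)) (at p)"
    using riemannian_metric_differentiable[OF g W(2)] by (simp add: frechet_derivative_works)
  then have "((\<lambda>q. metric_matrix g q $ c $ b) has_derivative frechet_derivative (\<lambda>q. metric_matrix g q $ b $ c) (at p)) (at p)"
    by (rule has_derivative_transform_within_open[OF _ W])
       (use g in \<open>auto simp: metric_matrix_def riemannian_metric_def\<close>)
  from frechet_derivative_at[OF this] show ?thesis by (simp add: pderiv_metric_def)
qed

lemma christoffel_sym:
  assumes "riemannian_metric W g" "open W" "p \<in> W"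
  shows "christoffel g p c a b = christoffel g p c b a"
  by (simp add: christoffel_def add.commute[of "pderiv_metric g p a b _"] pderiv_metric_sym[OF assms, of _ a b])

lemma levi_civita_torsion_free:
  assumes "riemannian_metric W g" "open W" "p \<in> W"
  shows "levi_civita g p (X p) Y - levi_civita g p (Y p) X =
    frechet_derivative Y (at p) (X p) - frechet_derivative X (at p) (Y p)"
proof -
  have "(\<Sum>a\<in>UNIV. \<Sum>b\<in>UNIV. christoffel g p c a b * X p $ a * Y p $ b) =
        (\<Sum>a\<in>UNIV. \<Sum>b\<in>UNIV. christoffel g p c a b * Y p $ a * X p $ b)" for c
    by (subst sum.swap) (simp add: christoffel_sym[OF assms, of c] mult_ac)
  then show ?thesis by (simp add: levi_civita_def)
qed

lemma metric_matrix_inv: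
  assumes "riemannian_metric W g" "p \<in> W"
  shows "metric_matrix g p ** matrix_inv (metric_matrix g p) = mat 1"
proof -
  have b: "bilinear (g p)" and pos: "\<And>v. v \<noteq> 0 \<Longrightarrow> 0 < g p v v"
    using assms by (auto simp: riemannian_metric_def)
  have "x = 0" if "metric_matrix g p *v x = 0" for x
  proof (rule ccontr)
    assume "x \<noteq> 0"
    have "g p x x = (\<Sum>b\<in>UNIV. x $ b * (metric_matrix g p *v x) $ b)"
      unfolding metric_matrix_expand[where g = g and q = p, OF b, of x x]
      by (simp add: matrix_vector_mult_def sum_distrib_left mult_ac)
    with that pos[OF \<open>x \<noteq> 0\<close>] show False by simp
  qed
  then have "invertible (metric_matrix g p)"
    by (simp add: invertible_left_inverse matrix_left_invertible_ker)
  then show ?thesis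
    unfolding invertible_def matrix_inv_def by (metis (mono_tags, lifting) someI_ex)
qed

lemma christoffel_lower:
  assumes "riemannian_metric W g" "p \<in> W"
  shows "(\<Sum>c\<in>UNIV. metric_matrix g p $ d $ c * christoffel g p c a b) =
    (1/2) * (pderiv_metric g p a b d + pderiv_metric g p b a d - pderiv_metric g p d a b)"
proof -
  let ?T = "\<lambda>e. pderiv_metric g p a b e + pderiv_metric g p b a e - pderiv_metric g p e a b"
  let ?G = "metric_matrix g p"
  have "(\<Sum>c\<in>UNIV. ?G $ d $ c * christoffel g p c a b) =
     (\<Sum>c\<in>UNIV. \<Sum>e\<in>UNIV. (1/2) * (?G $ d $ c * matrix_inv ?G $ c $ e * ?T e))"
    by (simp add: christoffel_def sum_distrib_left sum_divide_distrib mult_ac)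
  also have "\<dots> = (\<Sum>e\<in>UNIV. (1/2) * ((?G ** matrix_inv ?G) $ d $ e * ?T e))"
    by (subst sum.swap) (simp add: matrix_matrix_mult_def sum_distrib_left sum_distrib_right sum_divide_distrib)
  also have "\<dots> = (\<Sum>e\<in>UNIV. if e = d then (1/2) * ?T e else 0)"
    unfolding metric_matrix_inv[OF assms] by (intro sum.cong) (auto simp: mat_def)
  finally show ?thesis by simp
qed

lemma levi_civita_metric:
  assumes g: "riemannian_metric W g" and W: "open W" "p \<in> W"
    and Y: "Y differentiable (at p)" and Z: "Z differentiable (at p)"
  shows "frechet_derivative (\<lambda>q. g q (Y q) (Z q)) (at p) x =
    g p (levi_civita g p x Y) (Z p) + g p (Y p) (levi_civita g p x Z)"
proof -
  let ?G = "metric_matrix g" and ?d = "pderiv_metric g p"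
  have bil: "bilinear (g q)" and sym: "g q u v = g q v u" if "q \<in> W" for q u v
    using g that by (auto simp: riemannian_metric_def)
  define DY where "DY = frechet_derivative Y (at p)"
  define DZ where "DZ = frechet_derivative Z (at p)"
  define DG where "DG b c = frechet_derivative (\<lambda>q. ?G q $ b $ c) (at p)" for b c
  have hY: "(Y has_derivative DY) (at p)" and hZ: "(Z has_derivative DZ) (at p)"
    using Y Z by (auto simp: DY_def DZ_def frechet_derivative_works)
  have hG: "((\<lambda>q. ?G q $ b $ c) has_derivative DG b c) (at p)" for b c
    using riemannian_metric_differentiable[OF g W(2), of b c] by (simp add: DG_def frechet_derivative_works)
  have comp: "((\<lambda>q. F q $ b) has_derivative (\<lambda>v. F' v $ b)) (at p)"
    if "(F has_derivative F') (at p)" for F :: "real^'a \<Rightarrow> real^'a" and F' b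
    using bounded_linear.has_derivative[OF bounded_linear_vec_nth that] .
  have DGx: "DG b c x = (\<Sum>a\<in>UNIV. x $ a * ?d a b c)" for b c
  proof -
    interpret linear "DG b c" using hG[of b c] by (simp add: has_derivative_linear)
    have d: "?d a b c = DG b c (axis a 1)" for a by (simp add: pderiv_metric_def DG_def)
    have "DG b c x = DG b c (\<Sum>a\<in>UNIV. x $ a *s axis a 1)" by (simp add: basis_expansion)
    also have "\<dots> = (\<Sum>a\<in>UNIV. x $ a * ?d a b c)"
      by (simp add: scalar_mult_eq_scaleR sum scale d)
    finally show ?thesis .
  qed
  have "((\<lambda>q. \<Sum>b\<in>UNIV. \<Sum>c\<in>UNIV. ?G q $ b $ c * Y q $ b * Z q $ c) has_derivative
     (\<lambda>v. \<Sum>b\<in>UNIV. \<Sum>c\<in>UNIV. (?G p $ b $ c * Y p $ b) * DZ v $ c +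
        (?G p $ b $ c * DY v $ b + DG b c v * Y p $ b) * Z p $ c)) (at p)"
    by (intro has_derivative_sum has_derivative_mult hG comp hY hZ)
  then have "((\<lambda>q. g q (Y q) (Z q)) has_derivative
     (\<lambda>v. \<Sum>b\<in>UNIV. \<Sum>c\<in>UNIV. (?G p $ b $ c * Y p $ b) * DZ v $ c +
        (?G p $ b $ c * DY v $ b + DG b c v * Y p $ b) * Z p $ c)) (at p)"
    by (rule has_derivative_transform_within_open[OF _ W]) (simp add: metric_matrix_expand[of g] bil)
  from frechet_derivative_at[OF this, symmetric]
  have L: "frechet_derivative (\<lambda>q. g q (Y q) (Z q)) (at p) x =
     g p (Y p) (DZ x) + g p (DY x) (Z p) + (\<Sum>b\<in>UNIV. \<Sum>c\<in>UNIV. DG b c x * Y p $ b * Z p $ c)"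
    by (simp add: metric_matrix_expand[where g = g and q = p, OF bil[OF W(2)]] sum.distrib algebra_simps)
  have R: "g p (levi_civita g p x U) w = g p (frechet_derivative U (at p) x) w +
      (\<Sum>b\<in>UNIV. \<Sum>c\<in>UNIV. \<Sum>a\<in>UNIV. (1/2) * (?d a b c + ?d b a c - ?d c a b) * x $ a * U p $ b * w $ c)" for U w
  proof -
    let ?K = "\<chi> c. \<Sum>a\<in>UNIV. \<Sum>b\<in>UNIV. christoffel g p c a b * x $ a * U p $ b"
    have "g p ?K w = g p w ?K" using sym W by blast
    also have "\<dots> = (\<Sum>c\<in>UNIV. \<Sum>e\<in>UNIV. \<Sum>a\<in>UNIV. \<Sum>b\<in>UNIV.
        (?G p $ c $ e * christoffel g p e a b) * (x $ a * U p $ b * w $ c))"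
      by (simp add: metric_matrix_expand[where g = g and q = p, OF bil[OF W(2)], of w] sum_distrib_left sum_distrib_right mult_ac)
    also have "\<dots> = (\<Sum>c\<in>UNIV. \<Sum>a\<in>UNIV. \<Sum>b\<in>UNIV. \<Sum>e\<in>UNIV.
        (?G p $ c $ e * christoffel g p e a b) * (x $ a * U p $ b * w $ c))"
      by (subst sum.swap) (subst (2) sum.swap, rule refl)
    also have "\<dots> = (\<Sum>c\<in>UNIV. \<Sum>a\<in>UNIV. \<Sum>b\<in>UNIV.
        ((1/2) * (?d a b c + ?d b a c - ?d c a b)) * (x $ a * U p $ b * w $ c))"
      by (simp only: sum_distrib_right[symmetric] christoffel_lower[OF g W(2)])
    also have "\<dots> = (\<Sum>c\<in>UNIV. \<Sum>b\<in>UNIV. \<Sum>a\<in>UNIV. (1/2) * (?d a b c + ?d b a c - ?d c a b) * x $ a * U p $ b * w $ c)"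
      by (subst (2) sum.swap) (simp only: mult.assoc)
    also have "\<dots> = (\<Sum>b\<in>UNIV. \<Sum>c\<in>UNIV. \<Sum>a\<in>UNIV. (1/2) * (?d a b c + ?d b a c - ?d c a b) * x $ a * U p $ b * w $ c)"
      by (rule sum.swap)
    finally show ?thesis
      unfolding levi_civita_def using bilinear_ladd[OF bil[OF W(2)]] by simp
  qed
  have "(\<Sum>b\<in>UNIV. \<Sum>c\<in>UNIV. \<Sum>a\<in>UNIV. (1/2) * (?d a b c + ?d b a c - ?d c a b) * x $ a * Y p $ b * Z p $ c) +
        (\<Sum>b\<in>UNIV. \<Sum>c\<in>UNIV. \<Sum>a\<in>UNIV. (1/2) * (?d a b c + ?d b a c - ?d c a b) * x $ a * Z p $ b * Y p $ c) =
        (\<Sum>b\<in>UNIV. \<Sum>c\<in>UNIV. \<Sum>a\<in>UNIV. ((1/2) * (?d a b c + ?d b a c - ?d c a b) * x $ a * Y p $ b * Z p $ c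
           + (1/2) * (?d a c b + ?d c a b - ?d b a c) * x $ a * Z p $ c * Y p $ b))"
    by (subst (3) sum.swap) (simp only: sum.distrib)
  also have "\<dots> = (\<Sum>b\<in>UNIV. \<Sum>c\<in>UNIV. DG b c x * Y p $ b * Z p $ c)"
    unfolding DGx sum_distrib_right
    by (intro sum.cong refl) (simp add: pderiv_metric_sym[OF g W, of _ c b for c b] algebra_simps)
  finally show ?thesis
    unfolding L R DY_def DZ_def using sym[OF W(2), of "Y p" "levi_civita g p x Z"] R[of Z "Y p"] sym[OF W(2)]
    by (simp add: DZ_def)
qed

definition canonical :: "'m::finite tensor2 \<Rightarrow> 'm endo \<Rightarrow> real^'m \<Rightarrow> real^'m \<Rightarrow> 'm vfield \<Rightarrow> real^'m" where
  "canonical g J p x Y =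
     (1/2) *\<^sub>R (levi_civita g p x Y - J p (levi_civita g p x (\<lambda>q. J q (Y q))))"

definition canonical_cx ::
    "'m::finite tensor2 \<Rightarrow> 'm endo \<Rightarrow> real^'m \<Rightarrow> complex^'m \<Rightarrow> 'm cvfield \<Rightarrow> complex^'m" where
  "canonical_cx g J p w Z =
     (let D = canonical g J p; U = (\<lambda>q. reV (Z q)); V = (\<lambda>q. imV (Z q))
      in cxV (D (reV w) U - D (imV w) V) (D (reV w) V + D (imV w) U))"


subsection \<open>Unitary frames, curvature, Ricci form and scalar curvature\<close>

definition unitary_frame ::
    "(real^'m) set \<Rightarrow> 'm tensor2 \<Rightarrow> 'm endo \<Rightarrow> ('n::finite \<Rightarrow> 'm::finite cvfield) \<Rightarrow> bool" where
  "unitary_frame W g J z \<longleftrightarrow>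
     (\<forall>j. smooth_on W (z j)) \<and>
     (\<forall>p\<in>W. \<forall>j. ext_lin (J p) (z j p) = \<i> *s z j p) \<and>
     (\<forall>p\<in>W. \<forall>w. ext_lin (J p) w = \<i> *s w \<longrightarrow> (\<exists>c. w = (\<Sum>j\<in>UNIV. c j *s z j p))) \<and>
     (\<forall>p\<in>W. \<forall>j k. ext_bil (g p) (z j p) (cnjV (z k p)) = (if j = k then 1 else 0))"

text \<open>The dual coframe consists of forms of type (1,0): it also annihilates the conjugate frame.\<close>

definition dual_coframe :: "('n \<Rightarrow> 'm cvfield) \<Rightarrow> 'n \<Rightarrow> 'm::finite cform1" where
  "dual_coframe z k p =
     (THE \<phi>. Vector_Spaces.linear (*s) (*) \<phi> \<and>
        (\<forall>j. \<phi> (z j p) = (if j = k then 1 else 0)) \<and> (\<forall>j. \<phi> (cnjV (z j p)) = 0))"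

definition cnj_form :: "(complex^'m::finite \<Rightarrow> complex) \<Rightarrow> complex^'m \<Rightarrow> complex" where
  "cnj_form \<phi> w = cnj (\<phi> (cnjV w))"

text \<open>In \<open>conn_form\<close> and \<open>curv_form\<close> the first index is the upper one.\<close>

definition conn_form ::
    "'m::finite tensor2 \<Rightarrow> 'm endo \<Rightarrow> ('n::finite \<Rightarrow> 'm cvfield) \<Rightarrow> 'n \<Rightarrow> 'n \<Rightarrow> 'm cform1" where
  "conn_form g J z i j p w =
     (THE c. canonical_cx g J p w (z j) = (\<Sum>l\<in>UNIV. c l *s z l p)) i"

definition curv_form ::
    "'m::finite tensor2 \<Rightarrow> 'm endo \<Rightarrow> ('n::finite \<Rightarrow> 'm cvfield) \<Rightarrow> 'n \<Rightarrow> 'n \<Rightarrow> 'm cform2" where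
  "curv_form g J z i j p u v =
     ext_d1 (conn_form g J z i j) p u v +
     (\<Sum>k\<in>UNIV. wedge (conn_form g J z i k p) (conn_form g J z k j p) u v)"

definition proj10 :: "(real^'m::finite \<Rightarrow> real^'m) \<Rightarrow> complex^'m \<Rightarrow> complex^'m" where
  "proj10 j w = (1/2) *s (w - \<i> *s ext_lin j w)"

definition proj01 :: "(real^'m::finite \<Rightarrow> real^'m) \<Rightarrow> complex^'m \<Rightarrow> complex^'m" where
  "proj01 j w = (1/2) *s (w + \<i> *s ext_lin j w)"

definition part11 :: "(real^'m::finite \<Rightarrow> real^'m) \<Rightarrow> (complex^'m \<Rightarrow> complex^'m \<Rightarrow> complex) \<Rightarrow>
    complex^'m \<Rightarrow> complex^'m \<Rightarrow> complex" where
  "part11 j \<Psi> u v = \<Psi> (proj10 j u) (proj01 j v) + \<Psi> (proj01 j u) (proj10 j v)"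

definition curv_coeff ::
    "'m::finite tensor2 \<Rightarrow> 'm endo \<Rightarrow> ('n::finite \<Rightarrow> 'm cvfield) \<Rightarrow> 'n \<Rightarrow> 'n \<Rightarrow> real^'m \<Rightarrow>
     'n \<Rightarrow> 'n \<Rightarrow> complex" where
  "curv_coeff g J z i j p =
     (THE R. \<forall>u v. part11 (J p) (curv_form g J z i j p) u v =
        (\<Sum>k\<in>UNIV. \<Sum>l\<in>UNIV.
           R k l * wedge (dual_coframe z k p) (cnj_form (dual_coframe z l p)) u v))"

definition ricci_coeff ::
    "'m::finite tensor2 \<Rightarrow> 'm endo \<Rightarrow> ('n::finite \<Rightarrow> 'm cvfield) \<Rightarrow> real^'m \<Rightarrow> 'n \<Rightarrow> 'n \<Rightarrow> complex" where
  "ricci_coeff g J z p k l = (\<Sum>i\<in>UNIV. curv_coeff g J z i i p k l)"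

definition ricci_form ::
    "'m::finite tensor2 \<Rightarrow> 'm endo \<Rightarrow> ('n::finite \<Rightarrow> 'm cvfield) \<Rightarrow> 'm cform2" where
  "ricci_form g J z p u v =
     (\<Sum>k\<in>UNIV. \<Sum>l\<in>UNIV. ricci_coeff g J z p k l *
        wedge (dual_coframe z k p) (cnj_form (dual_coframe z l p)) u v)"

definition scal ::
    "'m::finite tensor2 \<Rightarrow> 'm endo \<Rightarrow> ('n::finite \<Rightarrow> 'm cvfield) \<Rightarrow> real^'m \<Rightarrow> complex" where
  "scal g J z p = (\<Sum>k\<in>UNIV. ricci_coeff g J z p k k)"


section \<open>Geometry on a quotient of a coordinate space\<close>

text \<open>
  Let \<open>N\<close> be the quotient of \<open>real^'m\<close>, with projection \<open>pr\<close>, by a group \<open>G\<close> of diffeomorphisms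
  acting freely and properly discontinuously.  Then \<open>pr\<close> is a smooth covering, and pulling back
  identifies the tensor fields on an open set \<open>V \<subseteq> N\<close> with the \<open>G\<close>-invariant tensor fields on
  \<open>pr -` V\<close>; all local operations (brackets, connections, exterior derivatives) are computed
  upstairs.  Fields on \<open>V\<close> are represented by these invariant lifts.
\<close>

definition quotient_open :: "(real^'m::finite \<Rightarrow> 'q) \<Rightarrow> 'q set \<Rightarrow> bool" where
  "quotient_open pr V \<longleftrightarrow> V \<subseteq> range pr \<and> open (pr -` V)"

definition almost_kaehler_quotient ::
    "(real^'m::finite \<Rightarrow> real^'m) set \<Rightarrow> 'm tensor2 \<Rightarrow> 'm endo \<Rightarrow> bool" where
  "almost_kaehler_quotient G g J \<longleftrightarrow> almost_kaehler UNIV g J \<and>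
     (\<forall>F\<in>G. \<forall>p u v. let D = frechet_derivative F (at p) in
        g (F p) (D u) (D v) = g p u v \<and> J (F p) (D v) = D (J p v))"

definition local_unitary_frame ::
    "(real^'m \<Rightarrow> 'q) \<Rightarrow> (real^'m \<Rightarrow> real^'m) set \<Rightarrow> 'm tensor2 \<Rightarrow> 'm endo \<Rightarrow> 'q set \<Rightarrow>
     ('n::finite \<Rightarrow> 'm::finite cvfield) \<Rightarrow> bool" where
  "local_unitary_frame pr G g J V z \<longleftrightarrow>
     quotient_open pr V \<and> unitary_frame (pr -` V) g J z \<and>
     (\<forall>F\<in>G. \<forall>p\<in>pr -` V. \<forall>j. z j (F p) = ext_lin (frechet_derivative F (at p)) (z j p))"


section \<open>The completely solvable Nakamura manifold\<close>

text \<open>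
  The coordinates \<open>(s, x, y\<^sup>1, y\<^sup>2, y\<^sup>3, y\<^sup>4)\<close> on the universal cover are the components
  \<open>$1, \<dots>, $6\<close> of a point of \<open>real^6\<close>.
\<close>

definition Lambda_mat :: "real \<Rightarrow> real^2^2" where
  "Lambda_mat \<zeta> = vector [vector [exp (- \<zeta>), 0], vector [0, exp \<zeta>]]"

definition real_mat :: "int^2^2 \<Rightarrow> real^2^2" where
  "real_mat A = (\<chi> i j. real_of_int (A $ i $ j))"

definition real_vec :: "int^2 \<Rightarrow> real^2" where
  "real_vec m = (\<chi> i. real_of_int (m $ i))"

definition nakamura_data :: "int^2^2 \<Rightarrow> real^2^2 \<Rightarrow> real \<Rightarrow> bool" where
  "nakamura_data A P \<zeta> \<longleftrightarrow> det A = 1 \<and> \<zeta> \<noteq> 0 \<and> invertible P \<and>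
     Lambda_mat \<zeta> = P ** real_mat A ** matrix_inv P"

definition torus_lattice :: "real^2^2 \<Rightarrow> (complex^2) set" where
  "torus_lattice P = {cxV (P *v real_vec a) (P *v real_vec b) | a b. True}"

definition torus_class :: "real^2^2 \<Rightarrow> complex^2 \<Rightarrow> (complex^2) set" where
  "torus_class P z = {z + \<gamma> | \<gamma>. \<gamma> \<in> torus_lattice P}"

definition circle_class :: "real \<Rightarrow> real set" where
  "circle_class x = {x + 2 * pi * of_int k | k. True}"

definition Lambda_act :: "real \<Rightarrow> complex^2 \<Rightarrow> complex^2" where
  "Lambda_act \<zeta> z = (\<chi> i. \<Sum>j\<in>UNIV. complex_of_real (Lambda_mat \<zeta> $ i $ j) * z $ j)"

definition T1 :: "real \<Rightarrow> real \<times> (complex^2) set \<Rightarrow> real \<times> (complex^2) set" where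
  "T1 \<zeta> = (\<lambda>(s, C). (s + \<zeta>, Lambda_act \<zeta> ` C))"

definition T1_orbit :: "real \<Rightarrow> real \<times> (complex^2) set \<Rightarrow> (real \<times> (complex^2) set) set" where
  "T1_orbit \<zeta> q = {q'. \<exists>n. (T1 \<zeta> ^^ n) q = q' \<or> (T1 \<zeta> ^^ n) q' = q}"

type_synonym nakamura_point = "real set \<times> (real \<times> (complex^2) set) set"

definition nak_pr :: "real^2^2 \<Rightarrow> real \<Rightarrow> real^6 \<Rightarrow> nakamura_point" where
  "nak_pr P \<zeta> p = (circle_class (p$2),
     T1_orbit \<zeta> (p$1, torus_class P (vector [Complex (p$3) (p$5), Complex (p$4) (p$6)])))"

text \<open>Points of the manifold are the elements of \<open>range (nak_pr P \<zeta>)\<close>.\<close>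

definition deck_map :: "real^2^2 \<Rightarrow> real \<Rightarrow> int \<Rightarrow> int \<Rightarrow> int^2 \<Rightarrow> int^2 \<Rightarrow> real^6 \<Rightarrow> real^6" where
  "deck_map P \<zeta> m k a b p =
     (let \<alpha> = P *v real_vec a; \<beta> = P *v real_vec b; r = of_int m * \<zeta>
      in vector [p$1 + r, p$2 + 2 * pi * of_int k,
           exp (- r) * p$3 + \<alpha>$1, exp r * p$4 + \<alpha>$2,
           exp (- r) * p$5 + \<beta>$1, exp r * p$6 + \<beta>$2])"

definition deck :: "real^2^2 \<Rightarrow> real \<Rightarrow> (real^6 \<Rightarrow> real^6) set" where
  "deck P \<zeta> = {deck_map P \<zeta> m k a b | m k a b. True}"

definition coframe :: "6 \<Rightarrow> real^6 \<Rightarrow> real^6 \<Rightarrow> real" where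
  "coframe i p v =
     (let s = p$1
      in vector [v$1, v$2, exp s * v$3, exp (- s) * v$4, exp s * v$5, exp (- s) * v$6] $ i)"

definition frame :: "6 \<Rightarrow> real^6 \<Rightarrow> real^6" where
  "frame i p =
     (let s = p$1; d = (\<lambda>a. axis a 1 :: real^6)
      in (vector [d 1, d 2, exp (- s) *\<^sub>R d 3, exp s *\<^sub>R d 4, exp (- s) *\<^sub>R d 5, exp s *\<^sub>R d 6]
            :: (real^6)^6) $ i)"

text \<open>The endomorphism field sending the \<open>i\<close>-th frame field to the \<open>i\<close>-th element of a list.\<close>

definition endo_on_frame :: "(real^6 \<Rightarrow> (real^6)^6) \<Rightarrow> 6 endo" where
  "endo_on_frame img p v = (\<Sum>i\<in>UNIV. coframe i p v *\<^sub>R img p $ i)"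

definition nak_J :: "6 endo" where
  "nak_J = endo_on_frame (\<lambda>p. let E = (\<lambda>i. frame i p)
     in vector [E 2, - E 1, E 4, - E 3, E 6, - E 5])"

definition nak_L :: "real^4 \<Rightarrow> 6 endo" where
  "nak_L t = endo_on_frame (\<lambda>p. let E = (\<lambda>i. frame i p)
     in vector [- t$1 *\<^sub>R E 1 - t$2 *\<^sub>R E 2, - t$2 *\<^sub>R E 1 + t$1 *\<^sub>R E 2,
                E 3, E 4,
                - t$3 *\<^sub>R E 5 - t$4 *\<^sub>R E 6, - t$4 *\<^sub>R E 5 + t$3 *\<^sub>R E 6])"

definition nak_omega :: "6 tensor2" where
  "nak_omega p u v =
     wedge (coframe 1 p) (coframe 2 p) u v + wedge (coframe 3 p) (coframe 4 p) u v +
     wedge (coframe 5 p) (coframe 6 p) u v"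

definition id_plus_L :: "real^4 \<Rightarrow> 6 endo" where
  "id_plus_L t p v = v + nak_L t p v"

definition nak_Jt :: "real^4 \<Rightarrow> 6 endo" where
  "nak_Jt t p v = id_plus_L t p (nak_J p (inv (id_plus_L t p) v))"

definition nak_gt :: "real^4 \<Rightarrow> 6 tensor2" where
  "nak_gt t p u v = nak_omega p u (nak_Jt t p v)"

subsection \<open>The cover and its deck group\<close>

text \<open>
  By \<open>nak_pr_eq_iff\<close> the fibres of \<open>nak_pr\<close> are the orbits of \<open>deck\<close>, and by \<open>frame_deck_invariant\<close> the
  frame fields descend to the quotient.
\<close>

lemma vector_6 [simp]:
  "(vector [a1,a2,a3,a4,a5,a6] :: 'a::zero^6) $ 1 = a1"
  "(vector [a1,a2,a3,a4,a5,a6] :: 'a::zero^6) $ 2 = a2"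
  "(vector [a1,a2,a3,a4,a5,a6] :: 'a::zero^6) $ 3 = a3"
  "(vector [a1,a2,a3,a4,a5,a6] :: 'a::zero^6) $ 4 = a4"
  "(vector [a1,a2,a3,a4,a5,a6] :: 'a::zero^6) $ 5 = a5"
  "(vector [a1,a2,a3,a4,a5,a6] :: 'a::zero^6) $ 6 = a6"
  by (simp_all add: vector_def)

lemma exhaust_6: "x = 1 \<or> x = 2 \<or> x = 3 \<or> x = 4 \<or> x = 5 \<or> x = (6::6)"
proof (induct x)
  case (of_int z)
  then have "0 \<le> z" and "z < 6" by simp_all
  then have "z = 0 \<or> z = 1 \<or> z = 2 \<or> z = 3 \<or> z = 4 \<or> z = 5" by arith
  then show ?case by auto
qed

lemma UNIV_6: "(UNIV :: 6 set) = {1,2,3,4,5,6}"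
  using exhaust_6 by auto

lemma forall_6: "(\<forall>i::6. P i) \<longleftrightarrow> P 1 \<and> P 2 \<and> P 3 \<and> P 4 \<and> P 5 \<and> P 6"
  by (metis exhaust_6)

lemma sum_6: "sum f (UNIV :: 6 set) = f 1 + f 2 + f 3 + f 4 + f 5 + f 6"
  unfolding UNIV_6 by (simp add: ac_simps)

lemma coframe_frame: "coframe i p (frame j p) = (if i = j then 1 else 0)"
proof -
  have "\<forall>i j. coframe i p (frame j p) = (if i = j then 1 else 0)"
    unfolding forall_6
    by (simp add: coframe_def frame_def Let_def axis_def exp_minus_inverse mult.commute)
  then show ?thesis by blast
qed

lemma frame_expansion: "v = (\<Sum>i\<in>UNIV. coframe i p v *\<^sub>R frame i p)"
  unfolding vec_eq_iff forall_6
  by (simp add: sum_6 coframe_def frame_def Let_def axis_def exp_minus)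

lemma deck_map_has_derivative:
  "(deck_map P \<zeta> m k a b has_derivative
     (\<lambda>v. let r = of_int m * \<zeta> in vector [v$1, v$2, exp (- r) * v$3, exp r * v$4, exp (- r) * v$5, exp r * v$6]))
   (at p)"
proof -
  have "((\<lambda>p. deck_map P \<zeta> m k a b p $ i) has_derivative
     (\<lambda>v. (let r = of_int m * \<zeta> in vector [v$1, v$2, exp (- r) * v$3, exp r * v$4, exp (- r) * v$5, exp r * v$6]) $ i)) (at p)" for i
  proof -
    have "\<forall>i. ((\<lambda>p. deck_map P \<zeta> m k a b p $ i) has_derivative
     (\<lambda>v. (let r = of_int m * \<zeta> in vector [v$1, v$2, exp (- r) * v$3, exp r * v$4, exp (- r) * v$5, exp r * v$6]) $ i)) (at p)"
      unfolding forall_6 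
      by (simp add: deck_map_def Let_def) (intro conjI; auto intro!: derivative_eq_intros bounded_linear_imp_has_derivative bounded_linear_vec_nth)
    then show ?thesis by blast
  qed
  then show ?thesis
    unfolding has_derivative_componentwise_within[of "deck_map P \<zeta> m k a b"]
    by (auto simp: Basis_vec_def inner_axis)
qed

lemma frame_deck_invariant:
  assumes "F \<in> deck P \<zeta>"
  shows "frechet_derivative F (at p) (frame i p) = frame i (F p)"
proof -
  obtain m k a b where F: "F = deck_map P \<zeta> m k a b" using assms by (auto simp: deck_def)
  have "\<forall>i. frechet_derivative F (at p) (frame i p) = frame i (F p)"
    unfolding F frechet_derivative_at[OF deck_map_has_derivative, symmetric] forall_6 vec_eq_iff
    by (simp add: frame_def deck_map_def Let_def axis_def flip: exp_add)
  then show ?thesis by blast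
qed


lemma Lambda_act_nth: "Lambda_act r z $ 1 = of_real (exp (- r)) * z $ 1" "Lambda_act r z $ 2 = of_real (exp r) * z $ 2"
  by (simp_all add: Lambda_act_def Lambda_mat_def sum_2)

lemma Lambda_act_add: "Lambda_act (r + q) z = Lambda_act r (Lambda_act q z)"
  unfolding vec_eq_iff forall_2 by (simp add: Lambda_act_nth exp_add exp_diff exp_minus field_simps)

lemma Lambda_act_0 [simp]: "Lambda_act 0 z = z"
  unfolding vec_eq_iff forall_2 by (simp add: Lambda_act_nth)

lemma Lambda_act_plus: "Lambda_act r (z + w) = Lambda_act r z + Lambda_act r w"
  unfolding vec_eq_iff forall_2 by (simp add: Lambda_act_nth algebra_simps)

lemma T1_funpow: "(T1 \<zeta> ^^ n) (s, C) = (s + of_nat n * \<zeta>, Lambda_act (of_nat n * \<zeta>) ` C)"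
  by (induction n) (auto simp: T1_def image_iff algebra_simps simp flip: Lambda_act_add)

lemma in_T1_orbit:
  "(s', C') \<in> T1_orbit \<zeta> (s, C) \<longleftrightarrow>
     (\<exists>m::int. s' = s + of_int m * \<zeta> \<and> C' = Lambda_act (of_int m * \<zeta>) ` C)"
proof
  assume "(s', C') \<in> T1_orbit \<zeta> (s, C)"
  then consider n where "(T1 \<zeta> ^^ n) (s, C) = (s', C')" | n where "(T1 \<zeta> ^^ n) (s', C') = (s, C)"
    by (auto simp: T1_orbit_def)
  then show "\<exists>m::int. s' = s + of_int m * \<zeta> \<and> C' = Lambda_act (of_int m * \<zeta>) ` C"
  proof cases
    case 1
    then show ?thesis by (intro exI[of _ "int n"]) (auto simp: T1_funpow)
  next
    case 2
    then show ?thesis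
      by (intro exI[of _ "- int n"]) (auto simp: T1_funpow image_image simp flip: Lambda_act_add)
  qed
next
  assume "\<exists>m::int. s' = s + of_int m * \<zeta> \<and> C' = Lambda_act (of_int m * \<zeta>) ` C"
  then obtain m :: int where m: "s' = s + of_int m * \<zeta>" "C' = Lambda_act (of_int m * \<zeta>) ` C" by blast
  show "(s', C') \<in> T1_orbit \<zeta> (s, C)"
  proof (cases "m \<ge> 0")
    case True
    then have "(T1 \<zeta> ^^ nat m) (s, C) = (s', C')" by (simp add: T1_funpow m)
    then show ?thesis by (auto simp: T1_orbit_def)
  next
    case False
    then have "(T1 \<zeta> ^^ nat (- m)) (s', C') = (s, C)"
      by (simp add: T1_funpow m image_image flip: Lambda_act_add)
    then show ?thesis by (auto simp: T1_orbit_def)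
  qed
qed

lemma T1_orbit_eq_iff: "T1_orbit \<zeta> q = T1_orbit \<zeta> q' \<longleftrightarrow> q' \<in> T1_orbit \<zeta> q"
proof
  assume "T1_orbit \<zeta> q = T1_orbit \<zeta> q'"
  moreover have "q' \<in> T1_orbit \<zeta> q'" by (auto simp: T1_orbit_def intro!: exI[of _ 0])
  ultimately show "q' \<in> T1_orbit \<zeta> q" by simp
next
  have trans: "b \<in> T1_orbit \<zeta> a \<Longrightarrow> c \<in> T1_orbit \<zeta> b \<Longrightarrow> c \<in> T1_orbit \<zeta> a" for a b c
  proof -
    assume "b \<in> T1_orbit \<zeta> a" "c \<in> T1_orbit \<zeta> b"
    then obtain m n :: int where
      mn: "fst b = fst a + of_int m * \<zeta>" "snd b = Lambda_act (of_int m * \<zeta>) ` snd a"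
      "fst c = fst b + of_int n * \<zeta>" "snd c = Lambda_act (of_int n * \<zeta>) ` snd b"
      using in_T1_orbit[of "fst b" "snd b" \<zeta> "fst a" "snd a"] in_T1_orbit[of "fst c" "snd c" \<zeta> "fst b" "snd b"]
      by (metis prod.collapse)
    have "fst c = fst a + of_int (n + m) * \<zeta>" "snd c = Lambda_act (of_int (n + m) * \<zeta>) ` snd a"
      unfolding mn by (auto simp: algebra_simps image_image simp flip: Lambda_act_add)
    then show ?thesis using in_T1_orbit[of "fst c" "snd c" \<zeta> "fst a" "snd a"] unfolding prod.collapse by blast
  qed
  have sym: "b \<in> T1_orbit \<zeta> a \<Longrightarrow> a \<in> T1_orbit \<zeta> b" for a b by (auto simp: T1_orbit_def)
  assume "q' \<in> T1_orbit \<zeta> q"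
  then show "T1_orbit \<zeta> q = T1_orbit \<zeta> q'" using trans sym by blast
qed

lemma real_vec_mult: "real_vec (A *v a) = real_mat A *v real_vec a"
  by (simp add: vec_eq_iff real_vec_def real_mat_def matrix_vector_mult_def)

lemma real_vec_add: "real_vec (a + b) = real_vec a + real_vec b"
  and real_vec_minus: "real_vec (- a) = - real_vec a"
  by (simp_all add: vec_eq_iff real_vec_def)

lemma cxV_add: "cxV a b + cxV c d = cxV (a + c) (b + d)"
  and cxV_minus: "- cxV a b = cxV (- a) (- b)"
  by (simp_all add: vec_eq_iff cxV_def complex_eq_iff)

lemma torus_lattice_add: "x \<in> torus_lattice P \<Longrightarrow> y \<in> torus_lattice P \<Longrightarrow> x + y \<in> torus_lattice P"
  unfolding torus_lattice_def
  by (clarsimp simp: cxV_add simp flip: matrix_vector_right_distrib real_vec_add) blast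

lemma matrix_vector_mult_minus: "A *v (- x) = - (A *v (x :: real^'n))"
  using matrix_vector_mult_scaleR[of A "-1" x] by simp

lemma torus_lattice_minus: "x \<in> torus_lattice P \<Longrightarrow> - x \<in> torus_lattice P"
  unfolding torus_lattice_def
  by (clarsimp simp: cxV_minus simp flip: matrix_vector_mult_minus real_vec_minus) blast

lemma torus_lattice_0: "0 \<in> torus_lattice P"
  unfolding torus_lattice_def
  by (clarsimp intro!: exI[of _ 0] simp: real_vec_def cxV_def vec_eq_iff matrix_vector_mult_def complex_eq_iff)

lemma torus_class_eq_iff: "torus_class P z = torus_class P w \<longleftrightarrow> (\<exists>\<gamma>\<in>torus_lattice P. w = z + \<gamma>)"
proof
  assume "torus_class P z = torus_class P w"
  moreover have "w \<in> torus_class P w"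
    using torus_lattice_0[of P] unfolding torus_class_def by force
  ultimately show "\<exists>\<gamma>\<in>torus_lattice P. w = z + \<gamma>" by (auto simp: torus_class_def)
next
  assume "\<exists>\<gamma>\<in>torus_lattice P. w = z + \<gamma>"
  then obtain \<gamma> where g: "\<gamma> \<in> torus_lattice P" "w = z + \<gamma>" by blast
  show "torus_class P z = torus_class P w"
  proof safe
    fix u assume "u \<in> torus_class P z"
    then obtain d where "d \<in> torus_lattice P" "u = z + d" by (auto simp: torus_class_def)
    then have "u = w + (d + - \<gamma>)" "d + - \<gamma> \<in> torus_lattice P"
      using g torus_lattice_add[of d P "- \<gamma>"] torus_lattice_minus[of \<gamma> P] by auto
    then show "u \<in> torus_class P w" unfolding torus_class_def by blast
  next
    fix u assume "u \<in> torus_class P w"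
    then obtain d where "d \<in> torus_lattice P" "u = w + d" by (auto simp: torus_class_def)
    then have "u = z + (\<gamma> + d)" "\<gamma> + d \<in> torus_lattice P"
      using g torus_lattice_add by (auto simp: add.assoc)
    then show "u \<in> torus_class P z" unfolding torus_class_def by blast
  qed
qed

lemma Lambda_act_cxV: "Lambda_act r (cxV a b) = cxV (Lambda_mat r *v a) (Lambda_mat r *v b)"
  unfolding vec_eq_iff forall_2
  by (simp add: Lambda_act_nth Lambda_mat_def cxV_def matrix_vector_mult_def sum_2 complex_eq_iff)

lemma Lambda_lattice:
  assumes "nakamura_data A P \<zeta>" "\<gamma> \<in> torus_lattice P"
  shows "Lambda_act \<zeta> \<gamma> \<in> torus_lattice P" "Lambda_act (- \<zeta>) \<gamma> \<in> torus_lattice P"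
proof -
  have inv: "matrix_inv P ** P = mat 1"
    using assms(1) unfolding nakamura_data_def invertible_def matrix_inv_def by (metis (mono_tags, lifting) someI_ex)
  have "Lambda_mat \<zeta> ** P = P ** real_mat A"
    using assms(1) inv by (simp add: nakamura_data_def flip: matrix_mul_assoc)
  then have LP: "Lambda_mat \<zeta> *v (P *v x) = P *v (real_mat A *v x)" for x
    by (simp add: matrix_vector_mul_assoc)
  obtain a b where g: "\<gamma> = cxV (P *v real_vec a) (P *v real_vec b)"
    using assms(2) by (auto simp: torus_lattice_def)
  show "Lambda_act \<zeta> \<gamma> \<in> torus_lattice P"
    unfolding g Lambda_act_cxV LP real_vec_mult[symmetric] torus_lattice_def by blast
  define B :: "int^2^2" where "B = vector [vector [A$2$2, - A$1$2], vector [- A$2$1, A$1$1]]"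
  have "A *v (B *v x) = x" for x
    using assms(1)
    unfolding vec_eq_iff forall_2 nakamura_data_def det_2
    by (simp add: B_def matrix_vector_mult_def sum_2) (auto simp: algebra_simps; algebra)
  then have "\<gamma> = Lambda_act \<zeta> (cxV (P *v real_vec (B *v a)) (P *v real_vec (B *v b)))"
    unfolding g Lambda_act_cxV LP by (simp flip: real_vec_mult)
  then have "Lambda_act (- \<zeta>) \<gamma> = cxV (P *v real_vec (B *v a)) (P *v real_vec (B *v b))"
    by (simp flip: Lambda_act_add)
  then show "Lambda_act (- \<zeta>) \<gamma> \<in> torus_lattice P"
    unfolding torus_lattice_def by blast
qed

lemma Lambda_lattice_int:
  assumes "nakamura_data A P \<zeta>" "\<gamma> \<in> torus_lattice P"
  shows "Lambda_act (of_int m * \<zeta>) \<gamma> \<in> torus_lattice P"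
proof -
  have *: "Lambda_act (of_nat n * \<zeta>) \<gamma> \<in> torus_lattice P \<and> Lambda_act (- (of_nat n * \<zeta>)) \<gamma> \<in> torus_lattice P" for n
  proof (induction n)
    case (Suc n)
    have "Lambda_act (of_nat (Suc n) * \<zeta>) \<gamma> = Lambda_act \<zeta> (Lambda_act (of_nat n * \<zeta>) \<gamma>)"
      "Lambda_act (- (of_nat (Suc n) * \<zeta>)) \<gamma> = Lambda_act (- \<zeta>) (Lambda_act (- (of_nat n * \<zeta>)) \<gamma>)"
      by (simp_all add: algebra_simps flip: Lambda_act_add)
    then show ?case using Suc Lambda_lattice[OF assms(1)] by metis
  qed (use assms in auto)
  show ?thesis
    using *[of "nat m"] *[of "nat (- m)"] by (cases "m \<ge> 0") auto
qed

lemma Lambda_torus_class: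
  assumes "nakamura_data A P \<zeta>"
  shows "Lambda_act (of_int m * \<zeta>) ` torus_class P z = torus_class P (Lambda_act (of_int m * \<zeta>) z)"
proof (intro set_eqI iffI)
  fix w assume "w \<in> Lambda_act (of_int m * \<zeta>) ` torus_class P z"
  then show "w \<in> torus_class P (Lambda_act (of_int m * \<zeta>) z)"
    using Lambda_lattice_int[OF assms] by (auto simp: torus_class_def Lambda_act_plus)
next
  fix w assume "w \<in> torus_class P (Lambda_act (of_int m * \<zeta>) z)"
  then obtain d where d: "d \<in> torus_lattice P" "w = Lambda_act (of_int m * \<zeta>) z + d"
    by (auto simp: torus_class_def)
  then have "w = Lambda_act (of_int m * \<zeta>) (z + Lambda_act (of_int (- m) * \<zeta>) d)"
    by (simp add: Lambda_act_plus flip: Lambda_act_add)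
  then show "w \<in> Lambda_act (of_int m * \<zeta>) ` torus_class P z"
    using Lambda_lattice_int[OF assms d(1), of "- m"] unfolding torus_class_def by blast
qed

lemma circle_class_eq_iff: "circle_class x = circle_class y \<longleftrightarrow> (\<exists>k::int. y = x + 2 * pi * of_int k)"
proof
  assume "circle_class x = circle_class y"
  moreover have "y \<in> circle_class y" by (auto simp: circle_class_def intro!: exI[of _ 0])
  ultimately show "\<exists>k::int. y = x + 2 * pi * of_int k" by (auto simp: circle_class_def)
next
  assume "\<exists>k::int. y = x + 2 * pi * of_int k"
  then obtain k :: int where k: "y = x + 2 * pi * of_int k" by blast
  show "circle_class x = circle_class y"
  proof safe
    fix u assume "u \<in> circle_class x"
    then obtain l :: int where "u = x + 2 * pi * of_int l" by (auto simp: circle_class_def)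
    then have "u = y + 2 * pi * of_int (l - k)" by (simp add: k algebra_simps)
    then show "u \<in> circle_class y" unfolding circle_class_def by blast
  next
    fix u assume "u \<in> circle_class y"
    then obtain l :: int where "u = y + 2 * pi * of_int l" by (auto simp: circle_class_def)
    then have "u = x + 2 * pi * of_int (l + k)" by (simp add: k algebra_simps)
    then show "u \<in> circle_class x" unfolding circle_class_def by blast
  qed
qed

lemma nak_pr_eq_iff:
  assumes "nakamura_data A P \<zeta>"
  shows "nak_pr P \<zeta> p = nak_pr P \<zeta> q \<longleftrightarrow> (\<exists>F\<in>deck P \<zeta>. q = F p)"
proof -
  define Z where "Z p = (vector [Complex (p$3) (p$5), Complex (p$4) (p$6)] :: complex^2)" for p :: "real^6"
  have *: "torus_class P w = torus_class P z \<longleftrightarrow>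
      (\<exists>a b. w = z + cxV (P *v real_vec a) (P *v real_vec b))" for w z
    by (subst eq_commute) (unfold torus_class_eq_iff torus_lattice_def, blast)
  have "nak_pr P \<zeta> p = nak_pr P \<zeta> q \<longleftrightarrow> (\<exists>k::int. q$2 = p$2 + 2 * pi * of_int k) \<and>
      (\<exists>m::int. q$1 = p$1 + of_int m * \<zeta> \<and>
         (\<exists>a b. Z q = Lambda_act (of_int m * \<zeta>) (Z p) + cxV (P *v real_vec a) (P *v real_vec b)))"
    unfolding nak_pr_def Z_def[symmetric] prod.inject circle_class_eq_iff T1_orbit_eq_iff in_T1_orbit
      Lambda_torus_class[OF assms] *
    by (rule refl)
  also have "\<dots> \<longleftrightarrow> (\<exists>m k a b. q = deck_map P \<zeta> m k a b p)"
  proof -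
    have "q = deck_map P \<zeta> m k a b p \<longleftrightarrow> q$2 = p$2 + 2 * pi * of_int k \<and> q$1 = p$1 + of_int m * \<zeta> \<and>
        Z q = Lambda_act (of_int m * \<zeta>) (Z p) + cxV (P *v real_vec a) (P *v real_vec b)" for m k a b
      unfolding vec_eq_iff forall_6 forall_2
      by (auto simp: deck_map_def Z_def Lambda_act_nth cxV_def Let_def complex_eq_iff)
    then show ?thesis by blast
  qed
  also have "\<dots> \<longleftrightarrow> (\<exists>F\<in>deck P \<zeta>. q = F p)" unfolding deck_def by blast
  finally show ?thesis .
qed

end

theory Submission
  imports Defs
begin

text \<open>
  The wedge terms cancel in the trace of the curvature, so the Ricci coefficients are those of the
  exterior derivative of \<open>\<Sum>\<^sub>i \<theta>\<^sup>i\<^sub>i\<close>.  A change of unitary frame by \<open>A\<close> changes this trace by the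
  closed form \<open>tr (A\<^sup>* dA)\<close>, so its exterior derivative may be computed in the global invariant frame.
  There Koszul's formula gives \<open>\<Sum>\<^sub>i \<theta>\<^sup>i\<^sub>i = \<i> a' ds\<close> with a constant \<open>a'\<close>, since \<open>J\<^sub>t\<close> has constant
  coefficients and preserves the commuting pairs \<open>E\<^sub>1, E\<^sub>2\<close>, \<open>E\<^sub>3, E\<^sub>4\<close> and \<open>E\<^sub>5, E\<^sub>6\<close>; this form is closed.
\<close>

section \<open>Smooth functions\<close>

text \<open>The local frame \<open>z\<close> is arbitrary, and its dual coframe, connection forms
  and curvature coefficients are given only by unique descriptions. The Hermitian pairing resolves
  all of them. Since pairing with \<open>cnjV (z k p)\<close> discards (0,1)-parts, the Levi-Civita
  connection may replace the canonical one in the connection forms. Koszul's formula then yields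
  both their values and their smoothness without inverting the metric matrix.

  It is not the trace form itself that vanishes: with a' = -2 t_4 / (1 - t_3^2 - t_4^2) it is
  nonzero as soon as t_4 is, and only its exterior derivative is zero.

  The parameter t enters only through two 2x2 blocks with c d = 1 + a^2 and c > 0; this relation
  carries J^2 = -1, compatibility, positivity and the cancellations in the connection forms.

  Closedness of tr (A* dA) rests on the symmetry of second derivatives, which is obtained from the
  mean value theorem because smoothness is phrased by iterated directional derivatives.\<close>

lemma Ck_cong:
  assumes "open W" "\<And>x. x \<in> W \<Longrightarrow> f x = g x" "Ck k f W"
  shows "Ck k g W"
  using assms(2,3)
proof (induction k arbitrary: f g)
  case 0
  then show ?case using continuous_on_cong by fastforce
next
  case (Suc k)
  have d: "(g has_derivative frechet_derivative f (at x)) (at x)" if "x \<in> W" for x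
  proof (rule has_derivative_transform_within_open[OF _ assms(1) that])
    show "(f has_derivative frechet_derivative f (at x)) (at x)"
      using Suc.prems(2) that by (simp add: frechet_derivative_works)
  qed (use Suc.prems(1) in auto)
  have "frechet_derivative g (at x) = frechet_derivative f (at x)" if "x \<in> W" for x
    using frechet_derivative_at[OF d[OF that]] by simp
  then show ?case
    using Suc.prems(2) d Suc.IH[of "\<lambda>x. frechet_derivative f (at x) v" "\<lambda>x. frechet_derivative g (at x) v" for v]
    by (fastforce simp: differentiable_def)
qed

lemma smooth_on_cong:
  assumes "open W" "smooth_on W f" "\<And>x. x \<in> W \<Longrightarrow> f x = g x"
  shows "smooth_on W g"
  using assms Ck_cong[of W f g] unfolding smooth_on_def by blast

lemma smooth_on_differentiable: "smooth_on W f \<Longrightarrow> p \<in> W \<Longrightarrow> f differentiable (at p)"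
  unfolding smooth_on_def using Ck.simps(2)[of 0 f W] by metis

lemma smooth_on_has_derivative:
  "smooth_on W f \<Longrightarrow> p \<in> W \<Longrightarrow> (f has_derivative frechet_derivative f (at p)) (at p)"
  using smooth_on_differentiable frechet_derivative_works by blast

lemma smooth_on_frechet_derivative:
  "smooth_on W f \<Longrightarrow> smooth_on W (\<lambda>x. frechet_derivative f (at x) v)"
  unfolding smooth_on_def using Ck.simps(2) by metis

lemma smooth_on_continuous: "smooth_on W f \<Longrightarrow> continuous_on W f"
  unfolding smooth_on_def using Ck.simps(1) by metis

lemma smooth_on_subset: "smooth_on W f \<Longrightarrow> V \<subseteq> W \<Longrightarrow> smooth_on V f"
proof -
  have "Ck k f W \<Longrightarrow> V \<subseteq> W \<Longrightarrow> Ck k f V" for k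
    by (induction k arbitrary: f) (auto intro: continuous_on_subset)
  then show "smooth_on W f \<Longrightarrow> V \<subseteq> W \<Longrightarrow> smooth_on V f" by (auto simp: smooth_on_def)
qed

text \<open>By uniqueness of derivatives an explicit \<open>f'\<close> may stand for the chosen
  \<open>frechet_derivative\<close>; the inductions over \<open>k\<close> below go through this
  rule.\<close>

lemma Ck_Suc_I:
  assumes "open W" "\<And>x. x \<in> W \<Longrightarrow> (f has_derivative f' x) (at x)" "\<And>v. Ck k (\<lambda>x. f' x v) W"
  shows "Ck (Suc k) f W"
proof -
  have "f' x = frechet_derivative f (at x)" if "x \<in> W" for x
    using frechet_derivative_at[OF assms(2)[OF that]] .
  then show ?thesis
    using Ck_cong[OF assms(1) _ assms(3), of v "\<lambda>x. frechet_derivative f (at x) v" for v] assms(2)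
    unfolding Ck.simps by (metis differentiable_def)
qed

lemma Ck_const: "Ck k (\<lambda>x. c) W"
  by (induction k arbitrary: c) auto

lemma smooth_on_const [simp]: "smooth_on W (\<lambda>x. c)"
  by (simp add: smooth_on_def Ck_const)

lemma Ck_imp_lower: "Ck (Suc k) f W \<Longrightarrow> Ck k f W"
  by (induction k arbitrary: f)
     (auto intro!: continuous_at_imp_continuous_on differentiable_imp_continuous_within)

lemma smooth_on_linear_compose:
  assumes "open W" "bounded_linear L" "smooth_on W f"
  shows "smooth_on W (\<lambda>x. L (f x))"
proof -
  have "Ck k (\<lambda>x. L (f x)) W" if "Ck k f W" for k
    using that
  proof (induction k arbitrary: f)
    case 0
    then show ?case using bounded_linear.continuous_on[OF assms(2)] by auto
  next
    case (Suc k)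
    then show ?case
      by (intro Ck_Suc_I[OF assms(1) bounded_linear.has_derivative[OF assms(2)]])
         (auto simp: frechet_derivative_works)
  qed
  then show ?thesis using assms(3) by (simp add: smooth_on_def)
qed

lemma Ck_add:
  assumes "open W" "Ck k f W" "Ck k g W"
  shows "Ck k (\<lambda>x. f x + g x) W"
  using assms(2,3)
proof (induction k arbitrary: f g)
  case (Suc k)
  show ?case
    by (rule Ck_Suc_I[OF assms(1), where f' = "\<lambda>x v. frechet_derivative f (at x) v + frechet_derivative g (at x) v"])
       (use Suc in \<open>auto simp: frechet_derivative_works intro!: has_derivative_add\<close>)
qed (auto intro: continuous_on_add)

lemma smooth_on_add:
  "open W \<Longrightarrow> smooth_on W f \<Longrightarrow> smooth_on W g \<Longrightarrow> smooth_on W (\<lambda>x. f x + g x)"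
  by (simp add: smooth_on_def Ck_add)

lemma smooth_on_minus: "open W \<Longrightarrow> smooth_on W f \<Longrightarrow> smooth_on W (\<lambda>x. - f x)"
  by (rule smooth_on_linear_compose) (auto intro: bounded_linear_minus bounded_linear_ident)

lemma smooth_on_diff:
  "open W \<Longrightarrow> smooth_on W f \<Longrightarrow> smooth_on W g \<Longrightarrow> smooth_on W (\<lambda>x. f x - g x)"
  using smooth_on_add[of W f "\<lambda>x. - g x"] smooth_on_minus by auto

lemma smooth_on_sum:
  "open W \<Longrightarrow> (\<And>i. i \<in> I \<Longrightarrow> smooth_on W (f i)) \<Longrightarrow> smooth_on W (\<lambda>x. \<Sum>i\<in>I. f i x)"
  by (induction I rule: infinite_finite_induct) (auto intro: smooth_on_add)

text \<open>The Leibniz rule leaves one factor undifferentiated in each summand, so the step from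
  \<open>k\<close> to \<open>Suc k\<close> also needs \<open>f\<close> and \<open>g\<close>
  themselves at order \<open>k\<close>, which \<open>Ck_imp_lower\<close> provides.\<close>

lemma Ck_bilinear:
  assumes W: "open W" and b: "bounded_bilinear b" and fg: "Ck k f W" "Ck k g W"
  shows "Ck k (\<lambda>x. b (f x) (g x)) W"
  using fg
proof (induction k arbitrary: f g)
  case 0
  then show ?case using bounded_bilinear.continuous_on[OF b] by auto
next
  case (Suc k)
  have "Ck k f W" "Ck k g W" using Suc.prems Ck_imp_lower by blast+
  then show ?case
    by (intro Ck_Suc_I[OF W bounded_bilinear.FDERIV[OF b]])
       (use Suc in \<open>auto simp: frechet_derivative_works intro!: Ck_add W\<close>)
qed

lemma smooth_on_bilinear:
  "open W \<Longrightarrow> bounded_bilinear b \<Longrightarrow> smooth_on W f \<Longrightarrow> smooth_on W g \<Longrightarrow>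
     smooth_on W (\<lambda>x. b (f x) (g x))"
  by (simp add: smooth_on_def Ck_bilinear)

lemma smooth_on_mult:
  fixes f g :: "_ \<Rightarrow> 'b::real_normed_algebra"
  shows "open W \<Longrightarrow> smooth_on W f \<Longrightarrow> smooth_on W g \<Longrightarrow> smooth_on W (\<lambda>x. f x * g x)"
  by (rule smooth_on_bilinear[OF _ bounded_bilinear_mult])

lemma smooth_on_scaleR:
  "open W \<Longrightarrow> smooth_on W f \<Longrightarrow> smooth_on W g \<Longrightarrow> smooth_on W (\<lambda>x. f x *\<^sub>R g x)"
  by (rule smooth_on_bilinear[OF _ bounded_bilinear_scaleR])

text \<open>The derivative contains \<open>exp (f x)\<close> again as a factor, so the induction on
  the order closes on itself.\<close>

lemma smooth_on_exp:
  fixes f :: "'a::real_normed_vector \<Rightarrow> real"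
  assumes "open W" "smooth_on W f"
  shows "smooth_on W (\<lambda>x. exp (f x))"
proof -
  have "Ck k (\<lambda>x. exp (f x)) W" for k
  proof (induction k)
    case 0
    then show ?case using smooth_on_continuous[OF assms(2)] by (auto intro: continuous_intros)
  next
    case (Suc k)
    show ?case
      by (rule Ck_Suc_I[OF assms(1), where f' = "\<lambda>x v. exp (f x) * frechet_derivative f (at x) v"])
         (use smooth_on_has_derivative[OF assms(2)] smooth_on_frechet_derivative[OF assms(2)] Suc in
           \<open>auto intro!: Ck_bilinear[OF assms(1) bounded_bilinear_mult] derivative_eq_intros simp: smooth_on_def\<close>)
  qed
  then show ?thesis by (simp add: smooth_on_def)
qed

lemma smooth_on_vec:
  fixes f :: "'a::real_normed_vector \<Rightarrow> 'b::euclidean_space^'n::finite"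
  assumes W: "open W" and f: "\<And>i. smooth_on W (\<lambda>x. f x $ i)"
  shows "smooth_on W f"
proof (rule smooth_on_cong[OF W])
  have "bounded_linear (axis i :: 'b \<Rightarrow> 'b^'n)" for i
    unfolding linear_conv_bounded_linear[symmetric]
    by (auto intro!: linearI simp: vec_eq_iff axis_def)
  then show "smooth_on W (\<lambda>x. \<Sum>i\<in>UNIV. axis i (f x $ i))"
    by (intro smooth_on_sum smooth_on_linear_compose[OF W _ f] W)
  show "(\<Sum>i\<in>UNIV. axis i (f x $ i)) = f x" for x
    by (simp add: vec_eq_iff axis_def if_distrib[of "\<lambda>v. v $ _"] cong: if_cong)
qed

lemma smooth_on_nth:
  "open W \<Longrightarrow> smooth_on W f \<Longrightarrow> smooth_on W (\<lambda>x. f x $ i)"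
  by (rule smooth_on_linear_compose[OF _ bounded_linear_vec_nth])

lemma smooth_on_id: "open W \<Longrightarrow> smooth_on W (\<lambda>x. x)"
  unfolding smooth_on_def
proof
  fix k assume W: "open W"
  show "Ck k (\<lambda>x. x) W"
    by (cases k) (auto intro!: Ck_Suc_I[OF W, where f' = "\<lambda>x v. v"] Ck_const continuous_on_id)
qed

lemma smooth_on_exp_nth:
  "smooth_on UNIV (\<lambda>p::real^'n::finite. exp (p $ i))" "smooth_on UNIV (\<lambda>p::real^'n::finite. exp (- p $ i))"
  by (intro smooth_on_exp smooth_on_minus smooth_on_nth smooth_on_id open_UNIV)+

section \<open>Symmetry of second derivatives\<close>

lemma mixed_second_difference:
  fixes f :: "'a::real_normed_vector \<Rightarrow> real"
  assumes W: "open W" and f: "Ck 2 f W" and h: "0 < h"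
    and box: "\<And>s t. 0 \<le> s \<Longrightarrow> s \<le> h \<Longrightarrow> 0 \<le> t \<Longrightarrow> t \<le> h \<Longrightarrow> p + s *\<^sub>R u + t *\<^sub>R v \<in> W"
  shows "\<exists>s t. 0 < s \<and> s < h \<and> 0 < t \<and> t < h \<and>
     f (p + h *\<^sub>R u + h *\<^sub>R v) - f (p + h *\<^sub>R u) - f (p + h *\<^sub>R v) + f p =
     h * h * frechet_derivative (\<lambda>q. frechet_derivative f (at q) u) (at (p + s *\<^sub>R u + t *\<^sub>R v)) v"
proof -
  let ?D = "\<lambda>q. frechet_derivative f (at q)"
  let ?Du = "\<lambda>q. frechet_derivative f (at q) u"
  have Df: "(f has_derivative ?D q) (at q)" if "q \<in> W" for q
    using f that by (simp add: numeral_2_eq_2 frechet_derivative_works)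
  have DDf: "(?Du has_derivative frechet_derivative ?Du (at q)) (at q)" if "q \<in> W" for q
    using f that by (simp add: numeral_2_eq_2 frechet_derivative_works)
  have along: "((\<lambda>s. F (a + s *\<^sub>R w)) has_real_derivative F' w) (at s)"
    if "(F has_derivative F') (at (a + s *\<^sub>R w))" for F :: "'a \<Rightarrow> real" and F' a s w
  proof -
    interpret bounded_linear F' using that by (rule has_derivative_bounded_linear)
    have "((\<lambda>s. F (a + s *\<^sub>R w)) has_derivative (\<lambda>d. F' (d *\<^sub>R w))) (at s)"
      using that
      by (intro has_derivative_compose[where g = F and g' = F' and f = "\<lambda>s. a + s *\<^sub>R w" and f' = "\<lambda>d. d *\<^sub>R w"])
         (auto intro!: derivative_eq_intros)
    then show ?thesis by (simp add: has_field_derivative_def scaleR mult_commute_abs)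
  qed
  \<comment> \<open>The mixed difference is the increment along \<open>u\<close> of the difference
    of \<open>f\<close> between the two edges parallel to \<open>u\<close>; a first mean value
    theorem applies to it.\<close>
  have "\<exists>s>0. s < h \<and>
     (f (p + h *\<^sub>R v + h *\<^sub>R u) - f (p + h *\<^sub>R u)) - (f (p + h *\<^sub>R v + 0 *\<^sub>R u) - f (p + 0 *\<^sub>R u)) =
     (h - 0) * (?D (p + h *\<^sub>R v + s *\<^sub>R u) u - ?D (p + s *\<^sub>R u) u)"
  proof (rule MVT2[OF h])
    fix s assume s: "0 \<le> s" "s \<le> h"
    show "((\<lambda>s. f (p + h *\<^sub>R v + s *\<^sub>R u) - f (p + s *\<^sub>R u)) has_real_derivative
        ?D (p + h *\<^sub>R v + s *\<^sub>R u) u - ?D (p + s *\<^sub>R u) u) (at s)"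
      using box[OF s, of h] box[OF s, of 0] h
      by (intro DERIV_diff along Df) (auto simp: algebra_simps)
  qed
  then obtain s where s: "0 < s" "s < h" and eq1:
    "f (p + h *\<^sub>R u + h *\<^sub>R v) - f (p + h *\<^sub>R u) - f (p + h *\<^sub>R v) + f p =
     h * (?Du (p + s *\<^sub>R u + h *\<^sub>R v) - ?Du (p + s *\<^sub>R u))"
    by (auto simp: algebra_simps)
  \<comment> \<open>Second mean value theorem, along \<open>v\<close>, for the derivative in
    direction \<open>u\<close>.\<close>
  have "\<exists>t>0. t < h \<and> ?Du (p + s *\<^sub>R u + h *\<^sub>R v) - ?Du (p + s *\<^sub>R u + 0 *\<^sub>R v) =
      (h - 0) * frechet_derivative ?Du (at (p + s *\<^sub>R u + t *\<^sub>R v)) v"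
  proof (rule MVT2[OF h])
    fix t assume t: "0 \<le> t" "t \<le> h"
    show "((\<lambda>t. ?Du (p + s *\<^sub>R u + t *\<^sub>R v)) has_real_derivative
        frechet_derivative ?Du (at (p + s *\<^sub>R u + t *\<^sub>R v)) v) (at t)"
      using box[of s t] s t by (intro along DDf) auto
  qed
  then obtain t where "0 < t" "t < h" "?Du (p + s *\<^sub>R u + h *\<^sub>R v) - ?Du (p + s *\<^sub>R u) =
      h * frechet_derivative ?Du (at (p + s *\<^sub>R u + t *\<^sub>R v)) v"
    by auto
  with s eq1 show ?thesis by (intro exI[of _ s] exI[of _ t]) auto
qed

lemma symmetric_second_derivative_real:
  fixes f :: "'a::real_normed_vector \<Rightarrow> real"
  assumes W: "open W" "p \<in> W" and f: "Ck 2 f W"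
  shows "frechet_derivative (\<lambda>q. frechet_derivative f (at q) u) (at p) v =
         frechet_derivative (\<lambda>q. frechet_derivative f (at q) v) (at p) u"
proof (rule ccontr)
  let ?D = "\<lambda>u v q. frechet_derivative (\<lambda>q. frechet_derivative f (at q) u) (at q) v"
  \<comment> \<open>Half the gap: one number that is closer than \<open>e\<close> to both values
    would contradict the triangle inequality.\<close>
  define e where "e = \<bar>?D u v p - ?D v u p\<bar> / 2"
  assume "?D u v p \<noteq> ?D v u p"
  then have e: "e > 0" by (simp add: e_def)
  have cont: "isCont (?D u v) p" for u v
    using f W by (simp add: numeral_2_eq_2 continuous_on_eq_continuous_at)
  obtain d1 where d1: "d1 > 0" "\<And>x. dist x p < d1 \<Longrightarrow> dist (?D u v x) (?D u v p) < e"
    using cont[of u v] e unfolding continuous_at_eps_delta by blast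
  obtain d2 where d2: "d2 > 0" "\<And>x. dist x p < d2 \<Longrightarrow> dist (?D v u x) (?D v u p) < e"
    using cont[of v u] e unfolding continuous_at_eps_delta by blast
  obtain d3 where d3: "d3 > 0" "ball p d3 \<subseteq> W" using W open_contains_ball by blast
  define d where "d = min d1 (min d2 d3)"
  have d: "d > 0" using d1 d2 d3 by (simp add: d_def)
  \<comment> \<open>The parallelogram with sides \<open>h u\<close> and \<open>h v\<close> then
    stays in the ball of radius \<open>d\<close>; the summand 1 covers the case that both vectors
    are zero.\<close>
  define h where "h = d / (norm u + norm v + 1)"
  have h: "h > 0" using d unfolding h_def by (intro divide_pos_pos) (auto intro: add_nonneg_pos)
  have near: "dist (p + s *\<^sub>R u + t *\<^sub>R v) p < d" if "0 \<le> s" "s \<le> h" "0 \<le> t" "t \<le> h" for s t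
  proof -
    have "dist (p + s *\<^sub>R u + t *\<^sub>R v) p \<le> s * norm u + t * norm v"
      using that norm_triangle_ineq[of "s *\<^sub>R u" "t *\<^sub>R v"] by (simp add: dist_norm algebra_simps)
    also have "\<dots> \<le> h * norm u + h * norm v" using that by (intro add_mono mult_right_mono) auto
    also have "\<dots> < h * (norm u + norm v + 1)" using h by (simp add: algebra_simps)
    also have "\<dots> = d" by (simp add: h_def add_nonneg_pos order_less_imp_not_eq2)
    finally show ?thesis .
  qed
  have box: "p + s *\<^sub>R u + t *\<^sub>R v \<in> W" if "0 \<le> s" "s \<le> h" "0 \<le> t" "t \<le> h" for s t
    using near[OF that] d3 by (auto simp: d_def dist_commute)
  have box': "p + s *\<^sub>R v + t *\<^sub>R u \<in> W" if "0 \<le> s" "s \<le> h" "0 \<le> t" "t \<le> h" for s t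
    using box[OF that(3,4) that(1,2)] by (simp add: algebra_simps)
  obtain s t where st: "0 < s" "s < h" "0 < t" "t < h"
     "f (p + h *\<^sub>R u + h *\<^sub>R v) - f (p + h *\<^sub>R u) - f (p + h *\<^sub>R v) + f p = h * h * ?D u v (p + s *\<^sub>R u + t *\<^sub>R v)"
    using mixed_second_difference[OF W(1) f h box] by blast
  obtain s' t' where st': "0 < s'" "s' < h" "0 < t'" "t' < h"
     "f (p + h *\<^sub>R v + h *\<^sub>R u) - f (p + h *\<^sub>R v) - f (p + h *\<^sub>R u) + f p = h * h * ?D v u (p + s' *\<^sub>R v + t' *\<^sub>R u)"
    using mixed_second_difference[OF W(1) f h box'] by blast
  \<comment> \<open>The mixed difference is symmetric in \<open>u\<close> and \<open>v\<close>, so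
    the two mixed derivatives share a value at points close to \<open>p\<close>.\<close>
  have "h * h * ?D u v (p + s *\<^sub>R u + t *\<^sub>R v) = h * h * ?D v u (p + t' *\<^sub>R u + s' *\<^sub>R v)"
    using st(5) st'(5) by (simp add: algebra_simps)
  then have "?D u v (p + s *\<^sub>R u + t *\<^sub>R v) = ?D v u (p + t' *\<^sub>R u + s' *\<^sub>R v)"
    using h by simp
  moreover have "dist (?D u v (p + s *\<^sub>R u + t *\<^sub>R v)) (?D u v p) < e"
    using near[of s t] st by (intro d1(2)) (auto simp: d_def)
  moreover have "dist (?D v u (p + t' *\<^sub>R u + s' *\<^sub>R v)) (?D v u p) < e"
    using near[of t' s'] st' by (intro d2(2)) (auto simp: d_def)
  ultimately show False using e unfolding e_def dist_real_def by (smt (verit) field_sum_of_halves)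
qed

section \<open>Complexified connections and unitary frames\<close>

lemma reV_cxV [simp]: "reV (cxV u v) = u" and imV_cxV [simp]: "imV (cxV u v) = v"
  by (simp_all add: reV_def imV_def cxV_def vec_eq_iff)

lemma complex_vec_eq_iff: "w = w' \<longleftrightarrow> reV w = reV w' \<and> imV w = imV w'"
  by (auto simp: reV_def imV_def vec_eq_iff complex_eq_iff)

lemma reV_simps [simp]:
  "reV (u + v) = reV u + reV v" "reV (u - v) = reV u - reV v" "reV (- u) = - reV u" "reV 0 = 0"
  "reV (c *s u) = Re c *\<^sub>R reV u - Im c *\<^sub>R imV u" "reV (cnjV u) = reV u"
  by (simp_all add: reV_def imV_def cnjV_def vec_eq_iff)

lemma imV_simps [simp]:
  "imV (u + v) = imV u + imV v" "imV (u - v) = imV u - imV v" "imV (- u) = - imV u" "imV 0 = 0"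
  "imV (c *s u) = Re c *\<^sub>R imV u + Im c *\<^sub>R reV u" "imV (cnjV u) = - imV u"
  by (simp_all add: reV_def imV_def cnjV_def vec_eq_iff)

lemma cnjV_cnjV [simp]: "cnjV (cnjV w) = w"
  and cnjV_scale: "cnjV (c *s u) = cnj c *s cnjV u"
  by (simp_all add: complex_vec_eq_iff)

lemma cnjV_sum: "cnjV (\<Sum>i\<in>I. f i) = (\<Sum>i\<in>I. cnjV (f i))"
  by (simp add: cnjV_def vec_eq_iff)

lemma bounded_linear_reV: "bounded_linear (reV :: complex^'m::finite \<Rightarrow> _)"
  and bounded_linear_imV: "bounded_linear (imV :: complex^'m::finite \<Rightarrow> _)"
  and bounded_linear_cnjV: "bounded_linear (cnjV :: complex^'m::finite \<Rightarrow> _)"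
proof -
  have "linear (reV :: complex^'m \<Rightarrow> _)" "linear (imV :: complex^'m \<Rightarrow> _)" "linear (cnjV :: complex^'m \<Rightarrow> _)"
    by (auto intro!: linearI simp: reV_def imV_def cnjV_def vec_eq_iff)
  then show "bounded_linear (reV :: complex^'m::finite \<Rightarrow> _)"
    "bounded_linear (imV :: complex^'m::finite \<Rightarrow> _)" "bounded_linear (cnjV :: complex^'m::finite \<Rightarrow> _)"
    by (simp_all add: linear_conv_bounded_linear)
qed

lemma ext_lin_simps:
  assumes "linear L"
  shows "ext_lin L (u + v) = ext_lin L u + ext_lin L v" "ext_lin L (u - v) = ext_lin L u - ext_lin L v"
    "ext_lin L (c *s u) = c *s ext_lin L u" "ext_lin L (cnjV u) = cnjV (ext_lin L u)"
  using assms
  by (simp_all add: complex_vec_eq_iff ext_lin_def linear_add linear_diff linear_scale linear_neg)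

lemma ext_bil_left:
  assumes "bilinear b"
  shows "ext_bil b (u + v) w = ext_bil b u w + ext_bil b v w"
    "ext_bil b (c *s u) w = c * ext_bil b u w" "ext_bil b 0 w = 0"
  using assms
  by (simp_all add: complex_eq_iff ext_bil_def bilinear_ladd bilinear_lsub bilinear_lmul
      bilinear_rmul bilinear_lzero algebra_simps)

lemma ext_bil_right:
  assumes "bilinear b"
  shows "ext_bil b w (u + v) = ext_bil b w u + ext_bil b w v"
    "ext_bil b w (c *s u) = c * ext_bil b w u" "ext_bil b w 0 = 0"
  using assms
  by (simp_all add: complex_eq_iff ext_bil_def bilinear_radd bilinear_rsub bilinear_lmul
      bilinear_rmul bilinear_rzero algebra_simps)

lemma ext_bil_sum_left:
  "bilinear b \<Longrightarrow> ext_bil b (\<Sum>i\<in>I. f i) w = (\<Sum>i\<in>I. ext_bil b (f i) w)"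
  by (induction I rule: infinite_finite_induct) (auto simp: ext_bil_left)

lemma ext_bil_sum_right:
  "bilinear b \<Longrightarrow> ext_bil b w (\<Sum>i\<in>I. f i) = (\<Sum>i\<in>I. ext_bil b w (f i))"
  by (induction I rule: infinite_finite_induct) (auto simp: ext_bil_right)

lemma ext_bil_commute: "(\<And>u v. b u v = b v u) \<Longrightarrow> ext_bil b u v = ext_bil b v u"
  by (metis (no_types, lifting) ext_bil_def add.commute)

lemma ext_bil_cnj:
  "bilinear b \<Longrightarrow> ext_bil b (cnjV u) (cnjV v) = cnj (ext_bil b u v)"
  by (simp add: complex_eq_iff ext_bil_def bilinear_lneg bilinear_rneg)

section \<open>Complexified Levi-Civita connection and Koszul's formula\<close>

definition ext_bilV :: "(real^'m::finite \<Rightarrow> real^'m \<Rightarrow> real^'m) \<Rightarrow> complex^'m \<Rightarrow> complex^'m \<Rightarrow> complex^'m" where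
  "ext_bilV b w w' = cxV (b (reV w) (reV w') - b (imV w) (imV w'))
                         (b (reV w) (imV w') + b (imV w) (reV w'))"

lemma ext_bilV_left:
  assumes "bilinear b"
  shows "ext_bilV b (u + v) w = ext_bilV b u w + ext_bilV b v w"
    "ext_bilV b (c *s u) w = c *s ext_bilV b u w"
  using assms
  by (simp_all add: complex_vec_eq_iff ext_bilV_def bilinear_ladd bilinear_lsub bilinear_lmul
      bilinear_rmul algebra_simps)

lemma ext_bilV_right:
  assumes "bilinear b"
  shows "ext_bilV b w (u + v) = ext_bilV b w u + ext_bilV b w v"
    "ext_bilV b w (c *s u) = c *s ext_bilV b w u" "ext_bilV b w 0 = 0"
  using assms
  by (simp_all add: complex_vec_eq_iff ext_bilV_def bilinear_radd bilinear_rsub bilinear_lmul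
      bilinear_rmul bilinear_rzero algebra_simps)

lemma ext_bilV_sum_right:
  "bilinear b \<Longrightarrow> ext_bilV b w (\<Sum>i\<in>I. f i) = (\<Sum>i\<in>I. ext_bilV b w (f i))"
  by (induction I rule: infinite_finite_induct) (auto simp: ext_bilV_right)

definition cdir_derivV :: "'m::finite cvfield \<Rightarrow> real^'m \<Rightarrow> complex^'m \<Rightarrow> complex^'m" where
  "cdir_derivV F p w =
     frechet_derivative F (at p) (reV w) + \<i> *s frechet_derivative F (at p) (imV w)"

text \<open>A constant field has zero derivative, so this isolates the zeroth-order part of the
  connection, which is bilinear.\<close>

definition christoffel_map :: "'m::finite tensor2 \<Rightarrow> real^'m \<Rightarrow> real^'m \<Rightarrow> real^'m \<Rightarrow> real^'m" where
  "christoffel_map g p x y = levi_civita g p x (\<lambda>_. y)"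

definition metric_deriv :: "'m::finite tensor2 \<Rightarrow> real^'m \<Rightarrow> real^'m \<Rightarrow> real^'m \<Rightarrow> real^'m \<Rightarrow> real" where
  "metric_deriv g p x u v = frechet_derivative (\<lambda>q. g q u v) (at p) x"

definition levi_civita_cx :: "'m::finite tensor2 \<Rightarrow> real^'m \<Rightarrow> complex^'m \<Rightarrow> 'm cvfield \<Rightarrow> complex^'m" where
  "levi_civita_cx g p w Z = cdir_derivV Z p w + ext_bilV (christoffel_map g p) w (Z p)"

lemma christoffel_map_eq:
  "christoffel_map g p x y = (\<chi> c. \<Sum>a\<in>UNIV. \<Sum>b\<in>UNIV. christoffel g p c a b * x $ a * y $ b)"
  by (simp add: christoffel_map_def levi_civita_def frechet_derivative_const)

lemma levi_civita_eq:
  "levi_civita g p x Y = frechet_derivative Y (at p) x + christoffel_map g p x (Y p)"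
  by (simp add: christoffel_map_eq levi_civita_def)

lemma bilinear_christoffel_map: "bilinear (christoffel_map g p)"
  unfolding bilinear_def
  by (auto intro!: linearI simp: christoffel_map_eq vec_eq_iff algebra_simps sum.distrib sum_distrib_left)

text \<open>The bracket terms of the usual formula are absent because constant coordinate fields
  commute. Torsion-freeness and metricity suffice, so the Christoffel symbols stay folded.\<close>

lemma koszul:
  assumes g: "riemannian_metric W g" and W: "open W" "p \<in> W"
  shows "2 * g p (christoffel_map g p x y) w =
    metric_deriv g p x y w + metric_deriv g p y x w - metric_deriv g p w x y"
proof -
  have sym: "christoffel_map g p a b = christoffel_map g p b a" for a b
    using levi_civita_torsion_free[OF g W, of "\<lambda>_. a" "\<lambda>_. b"]
    by (simp add: christoffel_map_def frechet_derivative_const)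
  have gsym: "g p a b = g p b a" for a b using g W by (auto simp: riemannian_metric_def)
  have met: "metric_deriv g p a b c = g p (christoffel_map g p a b) c + g p b (christoffel_map g p a c)" for a b c
    using levi_civita_metric[OF g W, of "\<lambda>_. b" "\<lambda>_. c" a]
    by (simp add: metric_deriv_def christoffel_map_def)
  show ?thesis
    using gsym[of y "christoffel_map g p x w"]
    by (simp add: met sym[of y x] sym[of w x] sym[of w y])
qed

lemma has_derivative_reV: "(Z has_derivative Z') F \<Longrightarrow> ((\<lambda>q. reV (Z q)) has_derivative (\<lambda>v. reV (Z' v))) F"
  by (rule bounded_linear.has_derivative[OF bounded_linear_reV])

lemma has_derivative_imV: "(Z has_derivative Z') F \<Longrightarrow> ((\<lambda>q. imV (Z q)) has_derivative (\<lambda>v. imV (Z' v))) F"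
  by (rule bounded_linear.has_derivative[OF bounded_linear_imV])

section \<open>Types of vectors and the canonical connection on a chart\<close>

locale almost_kaehler_chart =
  fixes W :: "(real^'m::finite) set" and g :: "'m tensor2" and J :: "'m endo"
  assumes open_W: "open W" and almost_kaehler: "almost_kaehler W g J"
begin

lemma metric: "riemannian_metric W g"
  and bilinear_g: "p \<in> W \<Longrightarrow> bilinear (g p)"
  and g_commute: "p \<in> W \<Longrightarrow> g p u v = g p v u"
  and smooth_g: "smooth_on W (\<lambda>p. g p u v)"
  and linear_J: "p \<in> W \<Longrightarrow> linear (J p)"
  and J_J: "p \<in> W \<Longrightarrow> J p (J p v) = - v"
  and g_J_J: "p \<in> W \<Longrightarrow> g p (J p u) (J p v) = g p u v"
  using almost_kaehler
  by (auto simp: almost_kaehler_def riemannian_metric_def almost_complex_def)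

lemma ext_lin_J_J: "p \<in> W \<Longrightarrow> ext_lin (J p) (ext_lin (J p) w) = - w"
  by (simp add: ext_lin_def complex_vec_eq_iff J_J)

lemma proj10_type: "p \<in> W \<Longrightarrow> ext_lin (J p) (proj10 (J p) w) = \<i> *s proj10 (J p) w"
  by (simp add: proj10_def ext_lin_simps linear_J ext_lin_J_J)

lemma proj01_cnj: "p \<in> W \<Longrightarrow> proj01 (J p) w = cnjV (proj10 (J p) (cnjV w))"
  by (simp add: proj01_def proj10_def ext_lin_simps linear_J) (simp add: complex_vec_eq_iff)

lemma proj_sum: "proj10 (J p) w + proj01 (J p) w = w"
  by (simp add: proj10_def proj01_def vec_eq_iff field_simps)

text \<open>\<open>J\<close> preserves the metric, while it multiplies the pairing of two
  (1,0)-vectors by \<open>\<i> * \<i> = -1\<close>.\<close>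

lemma ext_bil_type:
  assumes p: "p \<in> W" and "ext_lin (J p) u = \<i> *s u" "ext_lin (J p) v = \<i> *s v"
  shows "ext_bil (g p) u v = 0"
proof -
  have "ext_bil (g p) (ext_lin (J p) u) (ext_lin (J p) v) = ext_bil (g p) u v"
    by (simp add: ext_bil_def ext_lin_def g_J_J p)
  then show ?thesis by (simp add: assms ext_bil_left ext_bil_right bilinear_g)
qed

text \<open>The (0,1)-part of \<open>w\<close> and \<open>cnjV v\<close> are conjugates of
  (1,0)-vectors, hence orthogonal for the bilinear extension. This removes the projection from the
  connection forms.\<close>

lemma ext_bil_proj10:
  assumes p: "p \<in> W" and v: "ext_lin (J p) v = \<i> *s v"
  shows "ext_bil (g p) (proj10 (J p) w) (cnjV v) = ext_bil (g p) w (cnjV v)"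
proof -
  have "ext_bil (g p) (proj01 (J p) w) (cnjV v) = cnj (ext_bil (g p) (proj10 (J p) (cnjV w)) v)"
    by (simp add: proj01_cnj p ext_bil_cnj bilinear_g)
  also have "\<dots> = 0" using ext_bil_type[OF p proj10_type[OF p] v] by simp
  finally show ?thesis
    using ext_bil_left(1)[OF bilinear_g[OF p], of "proj10 (J p) w" "proj01 (J p) w" "cnjV v"]
    by (simp add: proj_sum)
qed

text \<open>For a (1,0)-field J Z = i Z, so the complexified definition becomes (D Z - i J D Z) / 2
  with D the Levi-Civita connection.\<close>

lemma canonical_cx_eq:
  assumes p: "p \<in> W" and Z: "smooth_on W Z" and t: "\<And>q. q \<in> W \<Longrightarrow> ext_lin (J q) (Z q) = \<i> *s Z q"
  shows "canonical_cx g J p w Z = proj10 (J p) (levi_civita_cx g p w Z)"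
proof -
  let ?D = "frechet_derivative Z (at p)"
  have JU: "J q (reV (Z q)) = - imV (Z q)" and JV: "J q (imV (Z q)) = reV (Z q)" if "q \<in> W" for q
    using t[OF that] by (simp_all add: ext_lin_def complex_vec_eq_iff)
  have Z': "(Z has_derivative ?D) (at p)" using Z p by (rule smooth_on_has_derivative)
  have dU: "frechet_derivative (\<lambda>q. reV (Z q)) (at p) = (\<lambda>v. reV (?D v))"
    using frechet_derivative_at[OF has_derivative_reV[OF Z']] by simp
  have dV: "frechet_derivative (\<lambda>q. imV (Z q)) (at p) = (\<lambda>v. imV (?D v))"
    using frechet_derivative_at[OF has_derivative_imV[OF Z']] by simp
  \<comment> \<open>\<open>J\<close> is never differentiated: for Z = U + i V the type condition
    says J U = -V and J V = U throughout the open set \<open>W\<close>.\<close>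
  have "((\<lambda>q. J q (reV (Z q))) has_derivative (\<lambda>v. - imV (?D v))) (at p)"
    by (rule has_derivative_transform_within_open[OF has_derivative_minus[OF has_derivative_imV[OF Z']] open_W p])
       (simp add: JU)
  from frechet_derivative_at[OF this]
  have dJU: "frechet_derivative (\<lambda>q. J q (reV (Z q))) (at p) = (\<lambda>v. - imV (?D v))" by simp
  have "((\<lambda>q. J q (imV (Z q))) has_derivative (\<lambda>v. reV (?D v))) (at p)"
    by (rule has_derivative_transform_within_open[OF has_derivative_reV[OF Z'] open_W p])
       (simp add: JV)
  from frechet_derivative_at[OF this]
  have dJV: "frechet_derivative (\<lambda>q. J q (imV (Z q))) (at p) = (\<lambda>v. reV (?D v))" by simp
  note b = bilinear_christoffel_map[of g p]
  note lin = linear_add[OF linear_J[OF p]] linear_diff[OF linear_J[OF p]] linear_neg[OF linear_J[OF p]]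
  show ?thesis
    unfolding canonical_cx_def Let_def canonical_def levi_civita_eq dU dV dJU dJV
      JU[OF p] JV[OF p] proj10_def levi_civita_cx_def cdir_derivV_def ext_bilV_def ext_lin_def
    by (simp add: complex_vec_eq_iff bilinear_rneg[OF b] lin algebra_simps)
qed

end

section \<open>Unitary frames: dual coframe and connection forms\<close>

locale unitary_frame_chart = almost_kaehler_chart W g J
  for W :: "(real^'m::finite) set" and g J +
  fixes z :: "'n::finite \<Rightarrow> 'm cvfield"
  assumes unitary_frame: "unitary_frame W g J z"
begin

lemma smooth_z: "smooth_on W (z j)"
  and z_type: "p \<in> W \<Longrightarrow> ext_lin (J p) (z j p) = \<i> *s z j p"
  and z_span: "p \<in> W \<Longrightarrow> ext_lin (J p) w = \<i> *s w \<Longrightarrow> \<exists>c. w = (\<Sum>j\<in>UNIV. c j *s z j p)"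
  and z_unitary: "p \<in> W \<Longrightarrow> ext_bil (g p) (z j p) (cnjV (z k p)) = (if j = k then 1 else 0)"
  using unitary_frame by (auto simp: unitary_frame_def)

lemma z_coeff:
  assumes p: "p \<in> W" and w: "w = (\<Sum>j\<in>UNIV. c j *s z j p)"
  shows "c k = ext_bil (g p) w (cnjV (z k p))"
proof -
  have "ext_bil (g p) w (cnjV (z k p)) = (\<Sum>j\<in>UNIV. if j = k then c j else 0)"
    unfolding w using bilinear_g[OF p]
    by (simp add: ext_bil_sum_left ext_bil_left z_unitary p if_distrib cong: if_cong)
  then show ?thesis by simp
qed

lemma z_expand10:
  assumes p: "p \<in> W" and w: "ext_lin (J p) w = \<i> *s w"
  shows "w = (\<Sum>j\<in>UNIV. ext_bil (g p) w (cnjV (z j p)) *s z j p)"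
  using z_span[OF p w] z_coeff[OF p] by (metis (no_types, lifting) sum.cong)

lemma proj10_expand:
  assumes p: "p \<in> W"
  shows "proj10 (J p) w = (\<Sum>j\<in>UNIV. ext_bil (g p) w (cnjV (z j p)) *s z j p)"
  using z_expand10[OF p proj10_type[OF p, of w]] by (simp add: ext_bil_proj10[OF p z_type[OF p]])

lemma proj01_expand:
  assumes p: "p \<in> W"
  shows "proj01 (J p) w = (\<Sum>j\<in>UNIV. ext_bil (g p) w (z j p) *s cnjV (z j p))"
proof -
  have "cnj (ext_bil (g p) (cnjV w) (cnjV (z j p))) = ext_bil (g p) w (z j p)" for j
    by (simp add: ext_bil_cnj bilinear_g p)
  then show ?thesis
    by (simp add: proj01_cnj p proj10_expand cnjV_sum cnjV_scale)
qed

lemma ext_bil_z_z: "p \<in> W \<Longrightarrow> ext_bil (g p) (z j p) (z k p) = 0"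
  by (rule ext_bil_type) (auto simp: z_type)

lemma ext_bil_cnj_cnj: "p \<in> W \<Longrightarrow> ext_bil (g p) (cnjV (z j p)) (cnjV (z k p)) = 0"
  using ext_bil_z_z by (simp add: ext_bil_cnj bilinear_g)

text \<open>Uniqueness holds because every vector is the sum of its two projections, which expand in
  the \<open>z j p\<close> and in their conjugates.\<close>

lemma dual_coframe_eq:
  assumes p: "p \<in> W"
  shows "dual_coframe z k p = (\<lambda>w. ext_bil (g p) w (cnjV (z k p)))"
  unfolding dual_coframe_def
proof (rule the_equality)
  let ?\<phi> = "\<lambda>w. ext_bil (g p) w (cnjV (z k p))"
  have lin: "Vector_Spaces.linear (*s) (*) ?\<phi>"
    by (unfold_locales) (auto simp: ext_bil_left bilinear_g p vector_space_assms algebra_simps)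
  show "Vector_Spaces.linear (*s) (*) ?\<phi> \<and> (\<forall>j. ?\<phi> (z j p) = (if j = k then 1 else 0)) \<and>
      (\<forall>j. ?\<phi> (cnjV (z j p)) = 0)"
    using lin by (auto simp: z_unitary p ext_bil_cnj_cnj)
  fix \<phi> assume \<phi>: "Vector_Spaces.linear (*s) (*) \<phi> \<and> (\<forall>j. \<phi> (z j p) = (if j = k then 1 else 0)) \<and>
      (\<forall>j. \<phi> (cnjV (z j p)) = 0)"
  then interpret \<phi>: Vector_Spaces.linear "(*s)" "(*)" \<phi> by blast
  have val: "\<phi> (z j p) = (if j = k then 1 else 0)" "\<phi> (cnjV (z j p)) = 0" for j
    using \<phi> by blast+
  show "\<phi> = ?\<phi>"
  proof
    fix w
    have "\<phi> w = \<phi> (proj10 (J p) w + proj01 (J p) w)" by (simp add: proj_sum)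
    also have "\<dots> = (\<Sum>j\<in>UNIV. if j = k then ?\<phi> w else 0)"
      unfolding proj10_expand[OF p] proj01_expand[OF p] \<phi>.add \<phi>.sum \<phi>.scale val
      by (simp add: if_distrib cong: if_cong)
    finally show "\<phi> w = ?\<phi> w" by simp
  qed
qed

text \<open>The canonical derivative is the projection of the Levi-Civita one, and the pairing with
  \<open>cnjV (z i p)\<close> does not see that projection.\<close>

lemma conn_form_eq:
  assumes p: "p \<in> W"
  shows "conn_form g J z i j p w = ext_bil (g p) (levi_civita_cx g p w (z j)) (cnjV (z i p))"
proof -
  let ?w = "canonical_cx g J p w (z j)"
  have w: "?w = proj10 (J p) (levi_civita_cx g p w (z j))"
    by (rule canonical_cx_eq[OF p smooth_z z_type])
  have ex: "?w = (\<Sum>l\<in>UNIV. ext_bil (g p) ?w (cnjV (z l p)) *s z l p)"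
    by (rule z_expand10[OF p]) (simp add: w proj10_type p)
  have "(THE c. ?w = (\<Sum>l\<in>UNIV. c l *s z l p)) = (\<lambda>l. ext_bil (g p) ?w (cnjV (z l p)))"
    by (rule the_equality[where P = "\<lambda>c. ?w = (\<Sum>l\<in>UNIV. c l *s z l p)", OF ex]) (use z_coeff[OF p] in blast)
  then show ?thesis
    by (simp add: conn_form_def w ext_bil_proj10[OF p z_type[OF p]])
qed

end

section \<open>Calculus of complexified directional derivatives\<close>

lemma symmetric_second_derivative_linear:
  fixes L :: "'b::real_normed_vector \<Rightarrow> real"
  assumes W: "open W" "p \<in> W" and f: "smooth_on W f" and L: "bounded_linear L"
  shows "L (frechet_derivative (\<lambda>q. frechet_derivative f (at q) u) (at p) v) =
         L (frechet_derivative (\<lambda>q. frechet_derivative f (at q) v) (at p) u)"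
proof -
  have D1: "frechet_derivative (\<lambda>q. L (f q)) (at q) w = L (frechet_derivative f (at q) w)" if "q \<in> W" for q w
    using frechet_derivative_at[OF bounded_linear.has_derivative[OF L smooth_on_has_derivative[OF f that]]]
    by metis
  have D2: "frechet_derivative (\<lambda>q. frechet_derivative (\<lambda>q. L (f q)) (at q) a) (at p) b =
      L (frechet_derivative (\<lambda>q. frechet_derivative f (at q) a) (at p) b)" for a b
  proof -
    have "((\<lambda>q. L (frechet_derivative f (at q) a)) has_derivative
        (\<lambda>b. L (frechet_derivative (\<lambda>q. frechet_derivative f (at q) a) (at p) b))) (at p)"
      by (intro bounded_linear.has_derivative[OF L] smooth_on_has_derivative[OF smooth_on_frechet_derivative[OF f] W(2)])
    then have "((\<lambda>q. frechet_derivative (\<lambda>q. L (f q)) (at q) a) has_derivative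
        (\<lambda>b. L (frechet_derivative (\<lambda>q. frechet_derivative f (at q) a) (at p) b))) (at p)"
      by (rule has_derivative_transform_within_open[OF _ W]) (simp add: D1)
    from frechet_derivative_at[OF this] show ?thesis by metis
  qed
  have "Ck 2 (\<lambda>q. L (f q)) W"
    using smooth_on_linear_compose[OF W(1) L f] by (simp add: smooth_on_def)
  from symmetric_second_derivative_real[OF W this, of u v] show ?thesis by (simp add: D2)
qed

lemma symmetric_second_derivative_complex:
  fixes f :: "'a::real_normed_vector \<Rightarrow> complex"
  assumes "open W" "p \<in> W" "smooth_on W f"
  shows "frechet_derivative (\<lambda>q. frechet_derivative f (at q) u) (at p) v =
         frechet_derivative (\<lambda>q. frechet_derivative f (at q) v) (at p) u"
  using symmetric_second_derivative_linear[OF assms bounded_linear_Re, of u v]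
    symmetric_second_derivative_linear[OF assms bounded_linear_Im, of u v]
  by (simp add: complex_eq_iff)

text \<open>Smoothness of \<open>b\<close> is given only on fixed vectors; expanding the real and
  imaginary parts of the fields in the coordinate basis reduces to that case.\<close>

lemma smooth_on_ext_bil:
  fixes Y Z :: "'m::finite cvfield"
  assumes W: "open W" and b: "\<And>q. q \<in> W \<Longrightarrow> bilinear (b q)" "\<And>u v. smooth_on W (\<lambda>q. b q u v)"
    and YZ: "smooth_on W Y" "smooth_on W Z"
  shows "smooth_on W (\<lambda>q. ext_bil (b q) (Y q) (Z q))"
proof -
  have real: "smooth_on W (\<lambda>q. b q (Y q) (Z q))" if "smooth_on W Y" "smooth_on W Z" for Y Z :: "'m vfield"
  proof (rule smooth_on_cong[OF W])
    show "smooth_on W (\<lambda>q. \<Sum>i\<in>UNIV. \<Sum>j\<in>UNIV. metric_matrix b q $ i $ j * Y q $ i * Z q $ j)"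
      unfolding metric_matrix_def
      using b(2) smooth_on_linear_compose[OF W bounded_linear_vec_nth that(1)]
        smooth_on_linear_compose[OF W bounded_linear_vec_nth that(2)]
      by (auto intro!: smooth_on_sum smooth_on_mult W)
    show "(\<Sum>i\<in>UNIV. \<Sum>j\<in>UNIV. metric_matrix b q $ i $ j * Y q $ i * Z q $ j) = b q (Y q) (Z q)"
      if "q \<in> W" for q
      by (rule metric_matrix_expand[where g = b and q = q, OF b(1)[OF that], symmetric])
  qed
  have of_real: "smooth_on W (\<lambda>q. complex_of_real (f q))" if "smooth_on W f" for f
    by (rule smooth_on_linear_compose[OF W bounded_linear_of_real that])
  have "smooth_on W (\<lambda>q. complex_of_real (b q (reV (Y q)) (reV (Z q)) - b q (imV (Y q)) (imV (Z q))) +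
      \<i> * complex_of_real (b q (reV (Y q)) (imV (Z q)) + b q (imV (Y q)) (reV (Z q))))"
    using YZ smooth_on_linear_compose[OF W bounded_linear_reV] smooth_on_linear_compose[OF W bounded_linear_imV]
    by (intro smooth_on_add smooth_on_diff smooth_on_mult of_real real W smooth_on_const) auto
  then show ?thesis by (simp add: ext_bil_def Complex_eq)
qed

lemma cdir_deriv_eq: "(f has_derivative f') (at p) \<Longrightarrow> cdir_deriv f p w = f' (reV w) + \<i> * f' (imV w)"
  using frechet_derivative_at[of f f' p] by (simp add: cdir_deriv_def)

lemma cdir_derivV_eq: "(f has_derivative f') (at p) \<Longrightarrow> cdir_derivV f p w = f' (reV w) + \<i> *s f' (imV w)"
  using frechet_derivative_at[of f f' p] by (simp add: cdir_derivV_def)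

lemma cdir_deriv_direction:
  assumes "f differentiable (at p)"
  shows "cdir_deriv f p (u + v) = cdir_deriv f p u + cdir_deriv f p v"
    and "cdir_deriv f p (c *s u) = c * cdir_deriv f p u"
proof -
  interpret linear "frechet_derivative f (at p)"
    using assms linear_frechet_derivative by blast
  show "cdir_deriv f p (u + v) = cdir_deriv f p u + cdir_deriv f p v"
    by (simp add: cdir_deriv_def add algebra_simps)
  show "cdir_deriv f p (c *s u) = c * cdir_deriv f p u"
    by (simp add: cdir_deriv_def add diff scale complex_eq_iff algebra_simps)
qed

lemma cdir_derivV_direction:
  fixes F :: "'m::finite cvfield"
  assumes "F differentiable (at p)"
  shows "cdir_derivV F p (u + v) = cdir_derivV F p u + cdir_derivV F p v"
    and "cdir_derivV F p (c *s u) = c *s cdir_derivV F p u"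
proof -
  interpret linear "frechet_derivative F (at p)"
    using assms linear_frechet_derivative by blast
  show "cdir_derivV F p (u + v) = cdir_derivV F p u + cdir_derivV F p v"
    by (simp add: cdir_derivV_def add vec_eq_iff algebra_simps)
  show "cdir_derivV F p (c *s u) = c *s cdir_derivV F p u"
    by (simp add: cdir_derivV_def add diff scale vec_eq_iff complex_eq_iff algebra_simps)
qed

lemma cdir_deriv_cong:
  assumes "open W" "p \<in> W" "\<And>q. q \<in> W \<Longrightarrow> f q = f' q" "f differentiable (at p)"
  shows "cdir_deriv f p w = cdir_deriv f' p w"
proof -
  have "(f has_derivative frechet_derivative f (at p)) (at p)"
    using assms(4) frechet_derivative_works by blast
  then have "(f' has_derivative frechet_derivative f (at p)) (at p)"
    using assms(1-3) by (rule has_derivative_transform_within_open)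
  from cdir_deriv_eq[OF this] show ?thesis by (simp add: cdir_deriv_def)
qed

lemma cdir_derivV_cong:
  assumes "open W" "p \<in> W" "\<And>q. q \<in> W \<Longrightarrow> f q = f' q" "f differentiable (at p)"
  shows "cdir_derivV f p w = cdir_derivV f' p w"
proof -
  have "(f has_derivative frechet_derivative f (at p)) (at p)"
    using assms(4) frechet_derivative_works by blast
  then have "(f' has_derivative frechet_derivative f (at p)) (at p)"
    using assms(1-3) by (rule has_derivative_transform_within_open)
  from cdir_derivV_eq[OF this] show ?thesis by (simp add: cdir_derivV_def)
qed

lemma cdir_deriv_const [simp]: "cdir_deriv (\<lambda>q. c) p w = 0"
  by (simp add: cdir_deriv_def frechet_derivative_const)

lemma cdir_deriv_add:
  assumes "f differentiable (at p)" "h differentiable (at p)"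
  shows "cdir_deriv (\<lambda>q. f q + h q) p w = cdir_deriv f p w + cdir_deriv h p w"
  using assms cdir_deriv_eq[OF has_derivative_add, of f "frechet_derivative f (at p)" p h "frechet_derivative h (at p)" w]
  by (simp add: frechet_derivative_works[symmetric] cdir_deriv_def algebra_simps)

lemma cdir_deriv_mult:
  assumes "f differentiable (at p)" "h differentiable (at p)"
  shows "cdir_deriv (\<lambda>q. f q * h q) p w = cdir_deriv f p w * h p + f p * cdir_deriv h p w"
  using assms cdir_deriv_eq[OF has_derivative_mult, of f "frechet_derivative f (at p)" p h "frechet_derivative h (at p)" w]
  by (simp add: frechet_derivative_works[symmetric] cdir_deriv_def algebra_simps)

lemma cdir_deriv_sum:
  assumes "\<And>i. i \<in> I \<Longrightarrow> f i differentiable (at p)"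
  shows "cdir_deriv (\<lambda>q. \<Sum>i\<in>I. f i q) p w = (\<Sum>i\<in>I. cdir_deriv (f i) p w)"
  using assms by (induction I rule: infinite_finite_induct) (auto simp: cdir_deriv_add differentiable_sum)

lemma cdir_derivV_add:
  assumes "f differentiable (at p)" "h differentiable (at p)"
  shows "cdir_derivV (\<lambda>q. f q + h q) p w = cdir_derivV f p w + cdir_derivV h p w"
  using assms cdir_derivV_eq[OF has_derivative_add, of f "frechet_derivative f (at p)" p h "frechet_derivative h (at p)" w]
  by (simp add: frechet_derivative_works[symmetric] cdir_derivV_def vec_eq_iff algebra_simps)

lemma cdir_derivV_sum:
  assumes "\<And>i. i \<in> I \<Longrightarrow> f i differentiable (at p)"
  shows "cdir_derivV (\<lambda>q. \<Sum>i\<in>I. f i q) p w = (\<Sum>i\<in>I. cdir_derivV (f i) p w)"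
  using assms
  by (induction I rule: infinite_finite_induct)
     (auto simp: cdir_derivV_add differentiable_sum, simp_all add: cdir_derivV_def frechet_derivative_const)

lemma bounded_bilinear_vec_scale: "bounded_bilinear (\<lambda>(c::complex) (w::complex^'m::finite). c *s w)"
proof -
  have "bilinear (\<lambda>(c::complex) (w::complex^'m). c *s w)"
    unfolding bilinear_def by (auto intro!: linearI simp: vec_eq_iff algebra_simps)
  then show ?thesis by (simp add: bilinear_conv_bounded_bilinear)
qed

lemma cdir_derivV_scale:
  assumes "f differentiable (at p)" "F differentiable (at p)"
  shows "cdir_derivV (\<lambda>q. f q *s F q) p w = cdir_deriv f p w *s F p + f p *s cdir_derivV F p w"
proof -
  have "((\<lambda>q. f q *s F q) has_derivative
      (\<lambda>v. f p *s frechet_derivative F (at p) v + frechet_derivative f (at p) v *s F p)) (at p)"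
    using assms by (intro bounded_bilinear.FDERIV[OF bounded_bilinear_vec_scale]) (auto simp: frechet_derivative_works)
  from cdir_derivV_eq[OF this] show ?thesis
    by (simp add: cdir_derivV_def cdir_deriv_def vec_eq_iff algebra_simps)
qed

lemma smooth_on_cdir_deriv:
  "open W \<Longrightarrow> smooth_on W f \<Longrightarrow> smooth_on W (\<lambda>q. cdir_deriv f q w)"
  unfolding cdir_deriv_def
  by (intro smooth_on_add smooth_on_mult smooth_on_const smooth_on_frechet_derivative)

lemma smooth_on_cdir_derivV:
  "open W \<Longrightarrow> smooth_on W F \<Longrightarrow> smooth_on W (\<lambda>q. cdir_derivV F q w)"
  unfolding cdir_derivV_def
  by (intro smooth_on_add smooth_on_bilinear[OF _ bounded_bilinear_vec_scale] smooth_on_const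
      smooth_on_frechet_derivative)

lemma cdir_deriv_commute:
  assumes W: "open W" "p \<in> W" and f: "smooth_on W f"
  shows "cdir_deriv (\<lambda>q. cdir_deriv f q u) p v = cdir_deriv (\<lambda>q. cdir_deriv f q v) p u"
proof -
  let ?DD = "\<lambda>a b. frechet_derivative (\<lambda>q. frechet_derivative f (at q) a) (at p) b"
  have "((\<lambda>q. cdir_deriv f q a) has_derivative (\<lambda>b. ?DD (reV a) b + \<i> * ?DD (imV a) b)) (at p)" for a
    unfolding cdir_deriv_def
    by (intro has_derivative_add has_derivative_mult_right
        smooth_on_has_derivative[OF smooth_on_frechet_derivative[OF f] W(2)])
  from cdir_deriv_eq[OF this]
  have E: "cdir_deriv (\<lambda>q. cdir_deriv f q a) p w = ?DD (reV a) (reV w) + \<i> * ?DD (imV a) (reV w) +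
      \<i> * (?DD (reV a) (imV w) + \<i> * ?DD (imV a) (imV w))" for a w .
  have sym: "?DD a b = ?DD b a" for a b
    by (rule symmetric_second_derivative_complex[OF W f])
  show ?thesis
    unfolding E sym[of "reV v"] sym[of "imV v"] by (simp add: algebra_simps)
qed

text \<open>Splitting only the direction \<open>w\<close> leaves real bilinear forms in the
  remaining arguments, to which \<open>koszul\<close> applies.\<close>

lemma ext_bil_ext_bilV:
  assumes "bilinear b"
  shows "ext_bil b (ext_bilV \<Gamma> w Y) Z =
     ext_bil (\<lambda>y. b (\<Gamma> (reV w) y)) Y Z + \<i> * ext_bil (\<lambda>y. b (\<Gamma> (imV w) y)) Y Z"
  using assms
  by (simp add: ext_bil_def ext_bilV_def complex_eq_iff bilinear_ladd bilinear_lsub)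

section \<open>Curvature and Ricci coefficients in a unitary frame\<close>

context unitary_frame_chart
begin

lemma differentiable_z: "p \<in> W \<Longrightarrow> z j differentiable (at p)"
  by (rule smooth_on_differentiable[OF smooth_z])

lemma conn_form_direction:
  assumes "p \<in> W"
  shows "conn_form g J z i j p (u + v) = conn_form g J z i j p u + conn_form g J z i j p v"
    and "conn_form g J z i j p (c *s u) = c * conn_form g J z i j p u"
  using assms
  by (simp_all add: conn_form_eq levi_civita_cx_def cdir_derivV_direction differentiable_z
      ext_bilV_left bilinear_christoffel_map ext_bil_left bilinear_g algebra_simps)

lemma smooth_on_conn_form: "smooth_on W (\<lambda>p. conn_form g J z i j p w)"
proof (rule smooth_on_cong[OF open_W])
  \<comment> \<open>The Christoffel symbols with lowered index: by Koszul's formula they are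
    combinations of derivatives of the metric, so no smoothness of the inverse metric matrix is
    required.\<close>
  define T where "T x q y = g q (christoffel_map g q x y)" for x q y
  have T_bil: "bilinear (T x q)" if "q \<in> W" for x q
    using bilinear_g[OF that] bilinear_christoffel_map[of g q]
    by (auto simp: bilinear_def[of "T x q"] T_def bilinear_ladd bilinear_radd bilinear_lmul bilinear_rmul
        intro!: linearI)
  have T_smooth: "smooth_on W (\<lambda>q. T x q u v)" for x u v
  proof (rule smooth_on_cong[OF open_W])
    show "smooth_on W (\<lambda>q. (1/2) * (metric_deriv g q x u v + metric_deriv g q u x v - metric_deriv g q v x u))"
      unfolding metric_deriv_def
      by (intro smooth_on_mult smooth_on_add smooth_on_diff smooth_on_const smooth_on_frechet_derivative
          smooth_g open_W)
  qed (use koszul[OF metric open_W] in \<open>simp add: T_def field_simps\<close>)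
  show "smooth_on W (\<lambda>p. ext_bil (g p) (cdir_derivV (z j) p w) (cnjV (z i p)) +
      (ext_bil (T (reV w) p) (z j p) (cnjV (z i p)) + \<i> * ext_bil (T (imV w) p) (z j p) (cnjV (z i p))))"
    by (intro smooth_on_add smooth_on_mult smooth_on_const smooth_on_ext_bil T_bil T_smooth bilinear_g smooth_g
        open_W smooth_on_cdir_derivV smooth_z smooth_on_linear_compose[OF open_W bounded_linear_cnjV])
  show "ext_bil (g p) (cdir_derivV (z j) p w) (cnjV (z i p)) +
      (ext_bil (T (reV w) p) (z j p) (cnjV (z i p)) + \<i> * ext_bil (T (imV w) p) (z j p) (cnjV (z i p))) =
      conn_form g J z i j p w" if "p \<in> W" for p
    using that
    by (simp add: conn_form_eq levi_civita_cx_def ext_bil_left bilinear_g ext_bil_ext_bilV T_def[abs_def])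
qed

lemma differentiable_conn_form: "p \<in> W \<Longrightarrow> (\<lambda>q. conn_form g J z i j q w) differentiable (at p)"
  by (rule smooth_on_differentiable[OF smooth_on_conn_form])

lemma curv_form_alternating: "curv_form g J z i j p u v = - curv_form g J z i j p v u"
  by (simp add: curv_form_def ext_d1_def wedge_def algebra_simps sum_subtractf)

text \<open>\<open>ext_d1\<close> differentiates the form evaluated at a fixed vector, so linearity
  in that vector has to be carried through the derivative.\<close>

lemma cdir_deriv_conn_form:
  assumes p: "p \<in> W"
  shows "cdir_deriv (\<lambda>q. conn_form g J z i j q (u + v)) p w =
      cdir_deriv (\<lambda>q. conn_form g J z i j q u) p w + cdir_deriv (\<lambda>q. conn_form g J z i j q v) p w"
    and "cdir_deriv (\<lambda>q. conn_form g J z i j q (c *s u)) p w =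
      c * cdir_deriv (\<lambda>q. conn_form g J z i j q u) p w"
proof -
  show "cdir_deriv (\<lambda>q. conn_form g J z i j q (u + v)) p w =
      cdir_deriv (\<lambda>q. conn_form g J z i j q u) p w + cdir_deriv (\<lambda>q. conn_form g J z i j q v) p w"
    using differentiable_conn_form[OF p]
    by (subst cdir_deriv_add[symmetric])
       (auto intro!: cdir_deriv_cong[OF open_W p] simp: conn_form_direction)
  show "cdir_deriv (\<lambda>q. conn_form g J z i j q (c *s u)) p w =
      c * cdir_deriv (\<lambda>q. conn_form g J z i j q u) p w"
    using differentiable_conn_form[OF p] cdir_deriv_mult[of "\<lambda>q. c" p "\<lambda>q. conn_form g J z i j q u" w]
      cdir_deriv_cong[OF open_W p, of "\<lambda>q. conn_form g J z i j q (c *s u)" "\<lambda>q. c * conn_form g J z i j q u" w]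
    by (auto simp: conn_form_direction)
qed

lemma curv_form_left:
  assumes p: "p \<in> W"
  shows "curv_form g J z i j p (u + v) w = curv_form g J z i j p u w + curv_form g J z i j p v w"
    and "curv_form g J z i j p (c *s u) w = c * curv_form g J z i j p u w"
  using p
  by (simp_all add: curv_form_def ext_d1_def wedge_def cdir_deriv_conn_form conn_form_direction
      cdir_deriv_direction differentiable_conn_form algebra_simps sum.distrib sum_subtractf sum_distrib_left)

lemma curv_form_right:
  assumes p: "p \<in> W"
  shows "curv_form g J z i j p w (u + v) = curv_form g J z i j p w u + curv_form g J z i j p w v"
    and "curv_form g J z i j p w (c *s u) = c * curv_form g J z i j p w u"
  using curv_form_left[OF p] curv_form_alternating[of i j p w] by simp_all

lemma curv_form_sum:
  assumes p: "p \<in> W" and "finite I"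
  shows "curv_form g J z i j p (\<Sum>k\<in>I. a k *s x k) w = (\<Sum>k\<in>I. a k * curv_form g J z i j p (x k) w)"
    and "curv_form g J z i j p w (\<Sum>k\<in>I. a k *s x k) = (\<Sum>k\<in>I. a k * curv_form g J z i j p w (x k))"
proof -
  have z: "curv_form g J z i j p 0 w = 0" "curv_form g J z i j p w 0 = 0"
    using curv_form_left(2)[OF p, of i j 0 0 w] curv_form_right(2)[OF p, of i j w 0 0] by auto
  show "curv_form g J z i j p (\<Sum>k\<in>I. a k *s x k) w = (\<Sum>k\<in>I. a k * curv_form g J z i j p (x k) w)"
    "curv_form g J z i j p w (\<Sum>k\<in>I. a k *s x k) = (\<Sum>k\<in>I. a k * curv_form g J z i j p w (x k))"
    using assms(2) by (induction I) (auto simp: z curv_form_left[OF p] curv_form_right[OF p])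
qed

text \<open>Existence comes from expanding the two projections in the frame. For uniqueness,
  evaluation on \<open>z k p\<close> and \<open>cnjV (z l p)\<close> annihilates every basic
  (1,1)-form except the one with indices \<open>k\<close> and \<open>l\<close>.\<close>

lemma curv_coeff_eq:
  assumes p: "p \<in> W"
  shows "curv_coeff g J z i j p k l = curv_form g J z i j p (z k p) (cnjV (z l p))"
proof -
  let ?\<Psi> = "curv_form g J z i j p"
  let ?P = "\<lambda>R. \<forall>u v. part11 (J p) ?\<Psi> u v =
        (\<Sum>k\<in>UNIV. \<Sum>l\<in>UNIV. R k l * wedge (dual_coframe z k p) (cnj_form (dual_coframe z l p)) u v)"
  let ?R = "\<lambda>k l. ?\<Psi> (z k p) (cnjV (z l p))"
  have cnj: "cnj_form (dual_coframe z l p) = (\<lambda>w. ext_bil (g p) w (z l p))" for l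
  proof
    fix w
    show "cnj_form (dual_coframe z l p) w = ext_bil (g p) w (z l p)"
      using ext_bil_cnj[OF bilinear_g[OF p], of "cnjV w" "cnjV (z l p)"]
      by (simp add: cnj_form_def dual_coframe_eq p)
  qed
  have R: "?P ?R"
  proof (intro allI)
    fix u v
    have 1: "?\<Psi> (proj10 (J p) a) (proj01 (J p) b) =
       (\<Sum>k\<in>UNIV. \<Sum>l\<in>UNIV. ?R k l * (ext_bil (g p) a (cnjV (z k p)) * ext_bil (g p) b (z l p)))" for a b
      by (subst sum.swap) (simp add: proj10_expand proj01_expand p curv_form_sum sum_distrib_left mult_ac)
    have "part11 (J p) ?\<Psi> u v = ?\<Psi> (proj10 (J p) u) (proj01 (J p) v) - ?\<Psi> (proj10 (J p) v) (proj01 (J p) u)"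
      using curv_form_alternating[of i j p "proj01 (J p) u"] by (simp add: part11_def)
    also have "\<dots> = (\<Sum>k\<in>UNIV. \<Sum>l\<in>UNIV. ?R k l *
        wedge (dual_coframe z k p) (cnj_form (dual_coframe z l p)) u v)"
      unfolding 1 cnj by (simp add: wedge_def dual_coframe_eq p right_diff_distrib sum_subtractf)
    finally show "part11 (J p) ?\<Psi> u v = (\<Sum>k\<in>UNIV. \<Sum>l\<in>UNIV. ?R k l *
        wedge (dual_coframe z k p) (cnj_form (dual_coframe z l p)) u v)" .
  qed
  have eval: "part11 (J p) ?\<Psi> (z k p) (cnjV (z l p)) = R k l" if "?P R" for R k l
  proof -
    have "wedge (dual_coframe z a p) (cnj_form (dual_coframe z b p)) (z k p) (cnjV (z l p)) =
        (if a = k \<and> b = l then 1 else 0)" for a b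
      using z_unitary[OF p, of b l] g_commute[OF p] unfolding cnj
      by (auto simp: wedge_def dual_coframe_eq p z_unitary ext_bil_z_z ext_bil_cnj_cnj
          ext_bil_commute[of "g p" "cnjV (z l p)"])
    then have "part11 (J p) ?\<Psi> (z k p) (cnjV (z l p)) = (\<Sum>a\<in>UNIV. \<Sum>b\<in>UNIV. if a = k \<and> b = l then R a b else 0)"
      using that by (auto intro!: sum.cong)
    also have "\<dots> = (\<Sum>a\<in>UNIV. if a = k then R k l else 0)"
      by (intro sum.cong) auto
    finally show ?thesis by simp
  qed
  have uniq: "R = ?R" if "?P R" for R
  proof (intro ext)
    show "R a b = ?R a b" for a b
      using eval[OF that, of a b] eval[OF R, of a b] by simp
  qed
  have "(THE R. ?P R) = ?R"
    by (rule the_equality[where P = ?P, OF R uniq])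
  then show ?thesis by (simp add: curv_coeff_def)
qed

text \<open>In the trace of the curvature the quadratic terms \<open>\<theta>\<^sup>i\<^sub>k \<and> \<theta>\<^sup>k\<^sub>i\<close> cancel in pairs.\<close>

lemma ricci_coeff_eq:
  assumes p: "p \<in> W"
  shows "ricci_coeff g J z p k l =
    ext_d1 (\<lambda>q w. \<Sum>i\<in>UNIV. conn_form g J z i i q w) p (z k p) (cnjV (z l p))"
proof -
  let ?\<theta> = "\<lambda>i j. conn_form g J z i j p"
  have "(\<Sum>i\<in>UNIV. \<Sum>k\<in>UNIV. ?\<theta> i k u * ?\<theta> k i v) = (\<Sum>i\<in>UNIV. \<Sum>k\<in>UNIV. ?\<theta> i k v * ?\<theta> k i u)" for u v
    by (subst sum.swap) (simp add: mult.commute)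
  then have "(\<Sum>i\<in>UNIV. \<Sum>k\<in>UNIV. wedge (?\<theta> i k) (?\<theta> k i) u v) = 0" for u v
    by (simp add: wedge_def sum_subtractf)
  then show ?thesis
    by (simp add: ricci_coeff_def curv_coeff_eq p curv_form_def sum.distrib ext_d1_def sum_subtractf
        cdir_deriv_sum differentiable_conn_form)
qed

end

section \<open>Change of unitary frame\<close>

text \<open>\<open>A\<^sup>* dA\<close> is the Maurer-Cartan form of the unitary group; its trace is closed because
  \<open>dA\<^sup>* = - A\<^sup>* dA A\<^sup>*\<close>, so that \<open>tr (dA\<^sup>* \<and> dA) = - tr (A\<^sup>* dA \<and> A\<^sup>* dA) = 0\<close>.\<close>

lemma trace_unitary_log_derivative_closed:
  fixes A :: "real^'m::finite \<Rightarrow> complex^'n^'n::finite"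
  assumes W: "open W" "p \<in> W" and A: "\<And>k j. smooth_on W (\<lambda>q. A q $ k $ j)"
    and unitary: "\<And>q i j. q \<in> W \<Longrightarrow> (\<Sum>k\<in>UNIV. cnj (A q $ k $ i) * A q $ k $ j) = (if i = j then 1 else 0)"
  shows "ext_d1 (\<lambda>q w. \<Sum>i\<in>UNIV. \<Sum>k\<in>UNIV. cnj (A q $ k $ i) * cdir_deriv (\<lambda>q. A q $ k $ i) q w) p u v = 0"
proof -
  define M where "M w = (\<chi> k i. cdir_deriv (\<lambda>q. A q $ k $ i) p w)" for w
  define N where "N w = (\<chi> i k. cdir_deriv (\<lambda>q. cnj (A q $ k $ i)) p w)" for w
  define B where "B = (\<chi> i k. cnj (A p $ k $ i))"
  have cnjA: "smooth_on W (\<lambda>q. cnj (A q $ k $ i))" for k i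
    by (rule smooth_on_linear_compose[OF W(1) bounded_linear_cnj A])
  have dA: "(\<lambda>q. A q $ k $ i) differentiable (at p)" "(\<lambda>q. cnj (A q $ k $ i)) differentiable (at p)"
    "(\<lambda>q. cdir_deriv (\<lambda>q. A q $ k $ i) q w) differentiable (at p)" for k i w
    using smooth_on_differentiable[OF A W(2)] smooth_on_differentiable[OF cnjA W(2)]
      smooth_on_differentiable[OF smooth_on_cdir_deriv[OF W(1) A] W(2)] by auto
  have "B ** A p = mat 1"
    by (simp add: B_def matrix_matrix_mult_def mat_def unitary[OF W(2)] vec_eq_iff)
  then have AB: "A p ** B = mat 1" by (simp add: matrix_left_right_inverse)
  have NM: "N w ** A p + B ** M w = 0" for w
  proof -
    have "(\<Sum>k\<in>UNIV. cdir_deriv (\<lambda>q. cnj (A q $ k $ i)) p w * A p $ k $ j +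
        cnj (A p $ k $ i) * cdir_deriv (\<lambda>q. A q $ k $ j) p w) = 0" for i j
    proof -
      have "cdir_deriv (\<lambda>q. \<Sum>k\<in>UNIV. cnj (A q $ k $ i) * A q $ k $ j) p w =
          cdir_deriv (\<lambda>q. if i = j then 1 else 0) p w"
        by (rule cdir_deriv_cong[OF W]) (auto simp: unitary intro!: differentiable_sum differentiable_mult dA)
      then show ?thesis by (simp add: cdir_deriv_sum cdir_deriv_mult differentiable_mult dA)
    qed
    then show ?thesis
      by (simp add: N_def M_def B_def matrix_matrix_mult_def vec_eq_iff sum.distrib)
  qed
  have N: "N w = - (B ** M w ** B)" for w
  proof -
    have "N w ** A p = - (B ** M w)" using NM[of w] by (simp add: eq_neg_iff_add_eq_0)
    then have "N w ** A p ** B = - (B ** M w) ** B" by simp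
    then have "N w = - (B ** M w) ** B" by (simp add: AB flip: matrix_mul_assoc)
    also have "\<dots> = - (B ** M w ** B)" by (simp add: matrix_matrix_mult_def vec_eq_iff sum_negf)
    finally show ?thesis .
  qed
  have tr: "trace (N a ** M b) = - trace ((B ** M a) ** (B ** M b))" for a b
    unfolding N by (simp add: matrix_mul_assoc) (simp add: matrix_matrix_mult_def trace_def sum_negf)
  have "cdir_deriv (\<lambda>q. \<Sum>i\<in>UNIV. \<Sum>k\<in>UNIV. cnj (A q $ k $ i) * cdir_deriv (\<lambda>q. A q $ k $ i) q b) p a =
     trace (N a ** M b) +
     (\<Sum>i\<in>UNIV. \<Sum>k\<in>UNIV. cnj (A p $ k $ i) * cdir_deriv (\<lambda>q. cdir_deriv (\<lambda>q. A q $ k $ i) q b) p a)" for a b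
    by (simp add: cdir_deriv_sum cdir_deriv_mult differentiable_mult differentiable_sum dA sum.distrib
        trace_def matrix_matrix_mult_def N_def M_def)
  \<comment> \<open>After antisymmetrising, the second-order terms cancel by symmetry of second
    derivatives, and the first-order terms by the cyclicity of the trace.\<close>
  then show ?thesis
    unfolding ext_d1_def tr
    by (simp add: trace_mul_sym[of "B ** M u"] cdir_deriv_commute[OF W A, of _ _ u v])
qed

section \<open>Transition matrices and the trace of the connection\<close>

locale unitary_frame_change =
  z: unitary_frame_chart W g J z + z': unitary_frame_chart W g J z'
  for W :: "(real^'m::finite) set" and g J and z z' :: "'n::finite \<Rightarrow> 'm cvfield"
begin

text \<open>Column \<open>j\<close> holds the coordinates of \<open>z j\<close> in the frame
  \<open>z'\<close>, so that z = z' A as rows of vectors.\<close>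

definition transition :: "real^'m \<Rightarrow> complex^'n^'n" where
  "transition q = (\<chi> k j. ext_bil (g q) (z j q) (cnjV (z' k q)))"

lemma smooth_transition: "smooth_on W (\<lambda>q. transition q $ k $ j)"
  unfolding transition_def
  by (simp, intro smooth_on_ext_bil z.open_W z.bilinear_g z.smooth_g z.smooth_z
      smooth_on_linear_compose[OF z.open_W bounded_linear_cnjV] z'.smooth_z)

lemma z_transition:
  "q \<in> W \<Longrightarrow> z j q = (\<Sum>k\<in>UNIV. transition q $ k $ j *s z' k q)"
  using z'.z_expand10[of q "z j q"] z.z_type by (simp add: transition_def)

lemma transition_unitary:
  assumes q: "q \<in> W"
  shows "(\<Sum>k\<in>UNIV. cnj (transition q $ k $ i) * transition q $ k $ j) = (if i = j then 1 else 0)"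
proof -
  have "ext_bil (g q) (z j q) (cnjV (z i q)) =
      ext_bil (g q) (z j q) (cnjV (\<Sum>k\<in>UNIV. transition q $ k $ i *s z' k q))"
    using z_transition[OF q, of i] by simp
  also have "\<dots> = (\<Sum>k\<in>UNIV. cnj (transition q $ k $ i) * transition q $ k $ j)"
    by (simp add: cnjV_sum cnjV_scale ext_bil_sum_right ext_bil_right z.bilinear_g q)
       (simp add: transition_def)
  finally show ?thesis by (auto simp: z.z_unitary q)
qed

lemma transition_unitary_right:
  assumes q: "q \<in> W"
  shows "(\<Sum>i\<in>UNIV. transition q $ k $ i * cnj (transition q $ l $ i)) = (if k = l then 1 else 0)"
proof -
  define B where "B = (\<chi> i k. cnj (transition q $ k $ i))"
  have "B ** transition q = mat 1"
    by (simp add: B_def matrix_matrix_mult_def mat_def transition_unitary[OF q] vec_eq_iff)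
  then have "transition q ** B = mat 1" by (simp add: matrix_left_right_inverse)
  then have "(transition q ** B) $ k $ l = (if k = l then 1 else 0)" by (simp add: mat_def)
  then show ?thesis by (simp add: B_def matrix_matrix_mult_def)
qed

lemma levi_civita_cx_transition:
  assumes q: "q \<in> W"
  shows "levi_civita_cx g q w (z j) =
    (\<Sum>k\<in>UNIV. cdir_deriv (\<lambda>q. transition q $ k $ j) q w *s z' k q +
       transition q $ k $ j *s levi_civita_cx g q w (z' k))"
proof -
  have d: "(\<lambda>q. transition q $ k $ j) differentiable (at q)" "z' k differentiable (at q)" for k
    using smooth_on_differentiable[OF smooth_transition q] z'.differentiable_z[OF q] by auto
  have dd: "(\<lambda>q. transition q $ k $ j *s z' k q) differentiable (at q)" for k
    using d bounded_bilinear.FDERIV[OF bounded_bilinear_vec_scale] unfolding differentiable_def by blast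
  have "cdir_derivV (z j) q w = cdir_derivV (\<lambda>q. \<Sum>k\<in>UNIV. transition q $ k $ j *s z' k q) q w"
    by (rule cdir_derivV_cong[OF z.open_W q z_transition z.differentiable_z[OF q]])
  also have "\<dots> = (\<Sum>k\<in>UNIV. cdir_deriv (\<lambda>q. transition q $ k $ j) q w *s z' k q +
       transition q $ k $ j *s cdir_derivV (z' k) q w)"
    by (simp add: cdir_derivV_sum dd cdir_derivV_scale d)
  finally show ?thesis
    using z_transition[OF q, of j]
    by (simp add: levi_civita_cx_def ext_bilV_sum_right ext_bilV_right bilinear_christoffel_map
        sum.distrib vector_add_ldistrib)
qed

text \<open>The transformation rule is \<theta> = A* dA + A* \<theta>' A. In the trace the factors A
  and A* of the second summand meet and cancel by \<open>transition_unitary_right\<close>.\<close>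

lemma trace_conn_form_transition:
  assumes q: "q \<in> W"
  shows "(\<Sum>i\<in>UNIV. conn_form g J z i i q w) = (\<Sum>i\<in>UNIV. conn_form g J z' i i q w) +
    (\<Sum>i\<in>UNIV. \<Sum>k\<in>UNIV. cnj (transition q $ k $ i) * cdir_deriv (\<lambda>q. transition q $ k $ i) q w)"
proof -
  let ?A = "\<lambda>k i. transition q $ k $ i" and ?\<theta> = "\<lambda>i j. conn_form g J z' i j q w"
  have "conn_form g J z i i q w = (\<Sum>l\<in>UNIV. cnj (?A l i) *
      (cdir_deriv (\<lambda>q. transition q $ l $ i) q w + (\<Sum>k\<in>UNIV. ?A k i * ?\<theta> l k)))" for i
  proof -
    have t: "ext_bil (g q) (levi_civita_cx g q w (z i)) (cnjV (z' l q)) =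
       cdir_deriv (\<lambda>q. transition q $ l $ i) q w + (\<Sum>k\<in>UNIV. ?A k i * ?\<theta> l k)" for l
      by (simp add: levi_civita_cx_transition q ext_bil_sum_left ext_bil_left z.bilinear_g z'.z_unitary
          z'.conn_form_eq sum.distrib if_distrib cong: if_cong)
    have "conn_form g J z i i q w =
       ext_bil (g q) (levi_civita_cx g q w (z i)) (cnjV (\<Sum>l\<in>UNIV. ?A l i *s z' l q))"
      using z_transition[OF q, of i] by (simp add: z.conn_form_eq q)
    also have "\<dots> = (\<Sum>l\<in>UNIV. cnj (?A l i) * ext_bil (g q) (levi_civita_cx g q w (z i)) (cnjV (z' l q)))"
      by (simp add: cnjV_sum cnjV_scale ext_bil_sum_right ext_bil_right z.bilinear_g q)
    finally show ?thesis unfolding t .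
  qed
  then have "(\<Sum>i\<in>UNIV. conn_form g J z i i q w) =
     (\<Sum>i\<in>UNIV. \<Sum>l\<in>UNIV. cnj (?A l i) * cdir_deriv (\<lambda>q. transition q $ l $ i) q w) +
     (\<Sum>i\<in>UNIV. \<Sum>l\<in>UNIV. \<Sum>k\<in>UNIV. (?A k i * cnj (?A l i)) * ?\<theta> l k)"
    by (simp add: sum.distrib sum_distrib_left algebra_simps)
  also have "(\<Sum>i\<in>UNIV. \<Sum>l\<in>UNIV. \<Sum>k\<in>UNIV. (?A k i * cnj (?A l i)) * ?\<theta> l k) =
     (\<Sum>l\<in>UNIV. \<Sum>k\<in>UNIV. (\<Sum>i\<in>UNIV. ?A k i * cnj (?A l i)) * ?\<theta> l k)"
    by (subst sum.swap, rule sum.cong[OF refl], subst sum.swap) (simp add: sum_distrib_right)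
  also have "\<dots> = (\<Sum>l\<in>UNIV. ?\<theta> l l)"
    by (simp add: transition_unitary_right[OF q] if_distrib[of "\<lambda>x. x * _"] cong: if_cong)
  finally show ?thesis by (simp add: add.commute)
qed

lemma ext_d1_trace_conn_form:
  assumes p: "p \<in> W"
  shows "ext_d1 (\<lambda>q w. \<Sum>i\<in>UNIV. conn_form g J z i i q w) p u v =
    ext_d1 (\<lambda>q w. \<Sum>i\<in>UNIV. conn_form g J z' i i q w) p u v"
proof -
  let ?\<tau> = "\<lambda>q w. \<Sum>i\<in>UNIV. \<Sum>k\<in>UNIV. cnj (transition q $ k $ i) * cdir_deriv (\<lambda>q. transition q $ k $ i) q w"
  have \<tau>: "(\<lambda>q. ?\<tau> q b) differentiable (at p)" for b
  proof (rule smooth_on_differentiable[OF _ p])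
    show "smooth_on W (\<lambda>q. ?\<tau> q b)"
      by (intro smooth_on_sum smooth_on_mult z.open_W smooth_on_cdir_deriv smooth_transition
          smooth_on_linear_compose[OF z.open_W bounded_linear_cnj])
  qed
  have "cdir_deriv (\<lambda>q. \<Sum>i\<in>UNIV. conn_form g J z i i q b) p a =
    cdir_deriv (\<lambda>q. \<Sum>i\<in>UNIV. conn_form g J z' i i q b) p a + cdir_deriv (\<lambda>q. ?\<tau> q b) p a" for a b
    using p \<tau>
    by (subst cdir_deriv_add[symmetric])
       (auto intro!: cdir_deriv_cong[OF z.open_W p] differentiable_sum z.differentiable_conn_form
         z'.differentiable_conn_form trace_conn_form_transition)
  then have "ext_d1 (\<lambda>q w. \<Sum>i\<in>UNIV. conn_form g J z i i q w) p u v =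
    ext_d1 (\<lambda>q w. \<Sum>i\<in>UNIV. conn_form g J z' i i q w) p u v + ext_d1 ?\<tau> p u v"
    by (simp add: ext_d1_def)
  also have "ext_d1 ?\<tau> p u v = 0"
    by (rule trace_unitary_log_derivative_closed[OF z.open_W p smooth_transition transition_unitary])
  finally show ?thesis by simp
qed

end

lemma ricci_coeff_zero:
  assumes "unitary_frame_change W g J z z'" "p \<in> W"
    and "\<And>u v. ext_d1 (\<lambda>q w. \<Sum>i\<in>UNIV. conn_form g J z' i i q w) p u v = 0"
  shows "ricci_coeff g J z p k l = 0"
proof -
  interpret unitary_frame_change W g J z z' by fact
  show ?thesis by (simp add: z.ricci_coeff_eq assms ext_d1_trace_conn_form)
qed

section \<open>A model of the invariant structures\<close>

text \<open>In the frame \<open>E\<^sub>1, \<dots>, E\<^sub>6\<close> the model structure is block diagonal, with block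
  \<open>(a, -d; c, -a)\<close> on \<open>E\<^sub>1, E\<^sub>2\<close>, the standard block on \<open>E\<^sub>3, E\<^sub>4\<close> and \<open>(a', -d'; c', -a')\<close> on
  \<open>E\<^sub>5, E\<^sub>6\<close>; the factors \<open>E\<close> and \<open>F\<close> below convert to coordinate components.\<close>

definition model_J :: "real \<Rightarrow> real \<Rightarrow> real \<Rightarrow> real \<Rightarrow> real \<Rightarrow> real \<Rightarrow> 6 endo" where
  "model_J a c d a' c' d' p v =
     (let E = exp (p$1); F = exp (- p$1) in
      vector [a * v$1 - d * v$2, c * v$1 - a * v$2, - (F * (F * v$4)), E * (E * v$3),
        a' * v$5 - d' * (F * (F * v$6)), c' * (E * (E * v$5)) - a' * v$6])"

text \<open>This is the standard symplectic form composed with \<open>model_J\<close>. Each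
  nonstandard plane has the Gram matrix (c, -a; -a, d); in the cross term of E_5 and E_6 the two
  exponentials cancel.\<close>

definition model_g :: "real \<Rightarrow> real \<Rightarrow> real \<Rightarrow> real \<Rightarrow> real \<Rightarrow> real \<Rightarrow> 6 tensor2" where
  "model_g a c d a' c' d' p u v =
     (let E = exp (p$1); F = exp (- p$1) in
      c * u$1 * v$1 - a * (u$1 * v$2 + u$2 * v$1) + d * u$2 * v$2 +
      (E * E) * (u$3 * v$3) + (F * F) * (u$4 * v$4) +
      c' * ((E * E) * (u$5 * v$5)) - a' * (u$5 * v$6 + u$6 * v$5) + d' * ((F * F) * (u$6 * v$6)))"

lemma exp_nth_has_derivative:
  "((\<lambda>q::real^'n::finite. exp (q $ i)) has_derivative (\<lambda>x. x $ i * exp (p $ i))) (at p)"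
  "((\<lambda>q::real^'n::finite. exp (- q $ i)) has_derivative (\<lambda>x. - (x $ i * exp (- p $ i)))) (at p)"
proof -
  have n: "((\<lambda>q::real^'n. q $ i) has_derivative (\<lambda>x. x $ i)) (at p)"
    by (rule bounded_linear_imp_has_derivative[OF bounded_linear_vec_nth])
  show "((\<lambda>q::real^'n::finite. exp (q $ i)) has_derivative (\<lambda>x. x $ i * exp (p $ i))) (at p)"
    by (rule has_derivative_exp[OF n, THEN has_derivative_eq_rhs]) (auto simp: fun_eq_iff)
  show "((\<lambda>q::real^'n::finite. exp (- q $ i)) has_derivative (\<lambda>x. - (x $ i * exp (- p $ i)))) (at p)"
    by (rule has_derivative_exp[OF has_derivative_minus[OF n], THEN has_derivative_eq_rhs]) (auto simp: fun_eq_iff)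
qed

text \<open>The last two equations cancel across a right-nested product, which is why the model
  writes \<open>F * (F * x)\<close> rather than a power or a single exponential.\<close>

lemma exp_minus_times:
  fixes x y :: real
  shows "exp (- x) * exp x = 1" "exp x * exp (- x) = 1"
    "exp (- x) * (exp x * y) = y" "exp x * (exp (- x) * y) = y"
  by (simp_all add: exp_minus)

text \<open>All coefficients depend on s alone, whence the factor \<open>x$1\<close>. The cross
  terms and the plane of E_1, E_2 carry no exponential and drop out.\<close>

lemma metric_deriv_model:
  "metric_deriv (model_g a c d a' c' d') p x u v =
     2 * x$1 * (let E = exp (p$1); F = exp (- p$1) in
       (E * E) * (u$3 * v$3) - (F * F) * (u$4 * v$4) + c' * ((E * E) * (u$5 * v$5)) - d' * ((F * F) * (u$6 * v$6)))"
proof -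
  have "((\<lambda>q. model_g a c d a' c' d' q u v) has_derivative (\<lambda>x.
     2 * x$1 * (let E = exp (p$1); F = exp (- p$1) in
       (E * E) * (u$3 * v$3) - (F * F) * (u$4 * v$4) + c' * ((E * E) * (u$5 * v$5)) - d' * ((F * F) * (u$6 * v$6))))) (at p)"
    unfolding model_g_def Let_def
    by (rule derivative_eq_intros exp_nth_has_derivative | rule refl)+ (simp add: fun_eq_iff algebra_simps)
  from frechet_derivative_at[OF this] show ?thesis by (simp add: metric_deriv_def fun_eq_iff)
qed

text \<open>Multiply by \<open>c\<close> and complete the square; the coefficient left at
  \<open>y\<close> squared is \<open>c * d - a * a = 1\<close>.\<close>

lemma quadratic_form_pos:
  fixes a c d x y :: real
  assumes "0 < c" "c * d = 1 + a * a" "x \<noteq> 0 \<or> y \<noteq> 0"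
  shows "0 < c * x * x - a * (x * y + y * x) + d * y * y"
proof -
  have "c * (c * x * x - a * (x * y + y * x) + d * y * y) = (c * x - a * y)\<^sup>2 + y\<^sup>2"
    using assms(2) unfolding power2_eq_square by algebra
  also have "0 < \<dots>"
    using assms by (cases "y = 0") (auto simp: add_nonneg_pos)
  finally show ?thesis using assms(1) zero_less_mult_pos by blast
qed

text \<open>On a plane the relation \<open>c * d = 1 + a * a\<close> says that the block squares to
  -1, equivalently that the Gram matrix has determinant 1; \<open>0 < c\<close> makes the latter
  positive definite.\<close>

locale nakamura_model =
  fixes a c d a' c' d' :: real
  assumes c_pos: "0 < c" "0 < c'" and cd: "c * d = 1 + a * a" "c' * d' = 1 + a' * a'"
begin

lemma cd_cancel: "c * (d * x) = (1 + a * a) * x" "c' * (d' * x) = (1 + a' * a') * x"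
  using cd by (simp_all flip: mult.assoc)

abbreviation "G \<equiv> model_g a c d a' c' d'"
abbreviation "JJ \<equiv> model_J a c d a' c' d'"

lemma model_g_pos:
  assumes "v \<noteq> 0"
  shows "0 < G p v v"
proof -
  define E where "E = exp (p$1)"
  define F where "F = exp (- p$1)"
  have EF: "E > 0" "F > 0" by (auto simp: E_def F_def)
  have eq: "G p v v = (c * v$1 * v$1 - a * (v$1 * v$2 + v$2 * v$1) + d * v$2 * v$2) + (E * v$3)\<^sup>2 + (F * v$4)\<^sup>2 +
     (c' * (E * v$5) * (E * v$5) - a' * ((E * v$5) * (F * v$6) + (F * v$6) * (E * v$5)) + d' * (F * v$6) * (F * v$6))"
  proof -
    have "E * F = 1" by (simp add: E_def F_def exp_minus_times)
    then show ?thesis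
      by (simp add: model_g_def Let_def power2_eq_square flip: E_def F_def)
  qed
  have nonneg: "0 \<le> c * x * x - a * (x * y + y * x) + d * y * y" "0 \<le> c' * x * x - a' * (x * y + y * x) + d' * y * y" for x y
    using quadratic_form_pos[OF c_pos(1) cd(1), of x y] quadratic_form_pos[OF c_pos(2) cd(2), of x y]
    by (cases "x = 0 \<and> y = 0"; force)+
  have "v$1 \<noteq> 0 \<or> v$2 \<noteq> 0 \<or> E * v$3 \<noteq> 0 \<or> F * v$4 \<noteq> 0 \<or> E * v$5 \<noteq> 0 \<or> F * v$6 \<noteq> 0"
    using assms EF by (auto simp: vec_eq_iff forall_6)
  then consider "v$1 \<noteq> 0 \<or> v$2 \<noteq> 0" | "E * v$3 \<noteq> 0" | "F * v$4 \<noteq> 0" | "E * v$5 \<noteq> 0 \<or> F * v$6 \<noteq> 0" by blast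
  moreover note nonneg(1)[of "v$1" "v$2"] nonneg(2)[of "E * v$5" "F * v$6"]
    zero_le_power2[of "E * v$3"] zero_le_power2[of "F * v$4"]
  ultimately show ?thesis
    unfolding eq
    using quadratic_form_pos[OF c_pos(1) cd(1), of "v$1" "v$2"] zero_less_power2[of "E * v$3"]
      zero_less_power2[of "F * v$4"] quadratic_form_pos[OF c_pos(2) cd(2), of "E * v$5" "F * v$6"]
    by cases linarith+
qed

lemma almost_kaehler_model: "almost_kaehler UNIV G JJ"
  unfolding almost_kaehler_def
proof (intro conjI ballI allI)
  show "riemannian_metric UNIV G"
    unfolding riemannian_metric_def
  proof (intro conjI ballI allI impI)
    show "bilinear (G p)" for p
      unfolding bilinear_def by (auto intro!: linearI simp: model_g_def Let_def algebra_simps)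
    show "G p u v = G p v u" for p u v by (simp add: model_g_def Let_def algebra_simps)
    show "0 < G p v v" if "v \<noteq> 0" for p v using model_g_pos[OF that] .
    show "smooth_on UNIV (\<lambda>p. G p u v)" for u v
      unfolding model_g_def Let_def
      by (intro smooth_on_add smooth_on_diff smooth_on_mult smooth_on_const smooth_on_exp_nth open_UNIV)
  qed
  show "almost_complex UNIV JJ"
    unfolding almost_complex_def
  proof (intro conjI ballI allI)
    show "linear (JJ p)" for p
      by (auto intro!: linearI simp: model_J_def Let_def vec_eq_iff forall_6 algebra_simps)
    show "JJ p (JJ p v) = - v" for p v
    proof -
      define E where "E = exp (p$1)"
      define F where "F = exp (- p$1)"
      have EF: "E * F = 1" by (simp add: E_def F_def exp_minus_times)
      show ?thesis
        using cd EF unfolding vec_eq_iff forall_6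
        by (simp add: model_J_def Let_def flip: E_def F_def) (intro conjI; algebra)
    qed
    have "smooth_on UNIV (\<lambda>p. JJ p v $ i)" for v i
    proof -
      have "\<forall>i. smooth_on UNIV (\<lambda>p. JJ p v $ i)"
        unfolding forall_6
        by (simp add: model_J_def Let_def)
           (intro conjI smooth_on_diff smooth_on_minus smooth_on_mult smooth_on_const smooth_on_exp_nth open_UNIV)
      then show ?thesis by blast
    qed
    then show "smooth_on UNIV (\<lambda>p. JJ p v)" for v by (intro smooth_on_vec) auto
  qed
  have EF: "exp (- p$1) * exp (p$1) = 1" for p :: "real^6" by (rule exp_minus_times)
  show "G p (JJ p u) (JJ p v) = G p u v" for p u v
    using cd EF[of p] by (simp add: model_g_def model_J_def Let_def) algebra
  \<comment> \<open>In coordinates the fundamental form has constant coefficients: E^3 and E^4 wedge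
    to dy^1 and dy^2 because their exponentials cancel, and likewise E^5 and E^6. Closedness is then
    immediate.\<close>
  have om: "(\<lambda>q. G q (JJ q u) v) = (\<lambda>_. u$1 * v$2 - u$2 * v$1 + u$3 * v$4 - u$4 * v$3 + u$5 * v$6 - u$6 * v$5)" for u v
  proof
    fix q :: "real^6"
    show "G q (JJ q u) v = u$1 * v$2 - u$2 * v$1 + u$3 * v$4 - u$4 * v$3 + u$5 * v$6 - u$6 * v$5"
      using cd EF[of q] by (simp add: model_g_def model_J_def Let_def) algebra
  qed
  show "ext_d2 (\<lambda>q a b. G q (JJ q a) b) p u v w = 0" for p u v w
    unfolding ext_d2_def om by (simp add: frechet_derivative_const)
qed


text \<open>The frame is split by weight in e^s, so that differentiation in s multiplies
  \<open>frame_const\<close>, \<open>frame_minus\<close> and \<open>frame_plus\<close> by 0, -1 and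
  1. The entries are those of E - i J E, for instance (1 - i a) E_1 - i c E_2, whose squared
  Hermitian length is 2 g(E, E) = 2 c.\<close>

definition frame_const :: "3 \<Rightarrow> complex^6" where
  "frame_const j = (vector [vector [Complex 1 (- a) / sqrt (2 * c), - \<i> * c / sqrt (2 * c), 0, 0, 0, 0], 0, 0] :: (complex^6)^3) $ j"

definition frame_minus :: "3 \<Rightarrow> complex^6" where
  "frame_minus j = (vector [0, vector [0, 0, 1 / sqrt 2, 0, 0, 0],
     vector [0, 0, 0, 0, Complex 1 (- a') / sqrt (2 * c'), 0]] :: (complex^6)^3) $ j"

definition frame_plus :: "3 \<Rightarrow> complex^6" where
  "frame_plus j = (vector [0, vector [0, 0, 0, - \<i> / sqrt 2, 0, 0],
     vector [0, 0, 0, 0, 0, - \<i> * c' / sqrt (2 * c')]] :: (complex^6)^3) $ j"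

text \<open>The normalised \<open>(1,0)\<close>-parts of the invariant fields \<open>E\<^sub>1, E\<^sub>3, E\<^sub>5\<close>.\<close>

definition model_frame :: "3 \<Rightarrow> 6 cvfield" where
  "model_frame j p = frame_const j + exp (- p$1) *\<^sub>R frame_minus j + exp (p$1) *\<^sub>R frame_plus j"

lemma model_frame_simps:
  "model_frame 1 p = vector [Complex 1 (- a) / sqrt (2 * c), - \<i> * c / sqrt (2 * c), 0, 0, 0, 0]"
  "model_frame 2 p = vector [0, 0, exp (- p$1) / sqrt 2, - \<i> * exp (p$1) / sqrt 2, 0, 0]"
  "model_frame 3 p = vector [0, 0, 0, 0, exp (- p$1) * Complex 1 (- a') / sqrt (2 * c'), - \<i> * c' * exp (p$1) / sqrt (2 * c')]"
  unfolding vec_eq_iff forall_6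
  by (simp_all add: model_frame_def frame_const_def frame_minus_def frame_plus_def scaleR_conv_of_real[where 'a = complex])

lemma model_frame_type: "ext_lin (JJ p) (model_frame j p) = \<i> *s model_frame j p"
proof -
  have "\<forall>j. ext_lin (JJ p) (model_frame j p) = \<i> *s model_frame j p"
    unfolding forall_3 model_frame_simps complex_vec_eq_iff vec_eq_iff forall_6
    using c_pos
    by (simp add: ext_lin_def model_J_def Let_def reV_def imV_def cxV_def field_simps exp_minus_times cd_cancel cd)
  then show ?thesis by blast
qed

lemma smooth_on_model_frame: "smooth_on UNIV (model_frame j)"
  unfolding model_frame_def[abs_def]
  by (intro smooth_on_add smooth_on_scaleR smooth_on_const smooth_on_exp_nth open_UNIV)

lemma cdir_derivV_model_frame:
  "cdir_derivV (model_frame j) p w = w$1 *s (exp (p$1) *\<^sub>R frame_plus j - exp (- p$1) *\<^sub>R frame_minus j)"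
proof -
  have "(model_frame j has_derivative
      (\<lambda>v. v$1 *\<^sub>R (exp (p$1) *\<^sub>R frame_plus j - exp (- p$1) *\<^sub>R frame_minus j))) (at p)"
    unfolding model_frame_def[abs_def]
    by (rule derivative_eq_intros exp_nth_has_derivative | rule refl)+ (simp add: fun_eq_iff algebra_simps)
  from cdir_derivV_eq[OF this] show ?thesis
    by (simp add: reV_def imV_def vec_eq_iff complex_eq_iff algebra_simps)
qed

lemma model_frame_unitary:
  "ext_bil (G p) (model_frame j p) (cnjV (model_frame k p)) = (if j = k then 1 else 0)"
proof -
  have "\<forall>j k. ext_bil (G p) (model_frame j p) (cnjV (model_frame k p)) = (if j = k then 1 else 0)"
    unfolding forall_3 model_frame_simps
    using c_pos
    by (simp add: ext_bil_def model_g_def Let_def reV_def imV_def cnjV_def complex_eq_iff field_simps exp_minus_times cd_cancel cd)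
  then show ?thesis by blast
qed

lemma model_frame_span:
  assumes "ext_lin (JJ p) w = \<i> *s w"
  shows "\<exists>x. w = (\<Sum>j\<in>UNIV. x j *s model_frame j p)"
proof -
  \<comment> \<open>In each plane the second component of the frame vector is nonzero, and dividing
    the component of \<open>w\<close> by it gives the coefficient.\<close>
  define x where "x j = (vector [\<i> * sqrt (2 * c) / c * w$2, \<i> * sqrt 2 * exp (- p$1) * w$4,
    \<i> * sqrt (2 * c') / c' * exp (- p$1) * w$6] :: complex^3) $ j" for j
  let ?E = "exp (p$1)" and ?F = "exp (- p$1)"
  \<comment> \<open>The type condition determines the fifth component of \<open>w\<close> from the
    sixth; the exponentials are moved to one side so that both sides compare after clearing
    denominators.\<close>
  have "c' * (?E * (?E * Re (w$5))) = a' * Re (w$6) - Im (w$6)"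
    "c' * (?E * (?E * Im (w$5))) = Re (w$6) + a' * Im (w$6)"
    using assms unfolding vec_eq_iff forall_6
    by (simp_all add: ext_lin_def model_J_def Let_def reV_def imV_def cxV_def complex_eq_iff)
  then have "?F * (?F * (?E * (?E * (c' * Re (w$5))))) = ?F * (?F * (a' * Re (w$6) - Im (w$6)))"
    "?F * (?F * (?E * (?E * (c' * Im (w$5))))) = ?F * (?F * (Re (w$6) + a' * Im (w$6)))"
    by (simp_all add: mult.left_commute[of c'])
  then have w5: "c' * Re (w$5) = ?F * (?F * (a' * Re (w$6) - Im (w$6)))"
    "c' * Im (w$5) = ?F * (?F * (Re (w$6) + a' * Im (w$6)))"
    by (simp_all add: exp_minus_times)
  have "w = (\<Sum>j\<in>UNIV. x j *s model_frame j p)"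
    using assms c_pos w5
    unfolding vec_eq_iff forall_6 sum_3 model_frame_simps complex_vec_eq_iff
    by (simp add: x_def ext_lin_def model_J_def Let_def reV_def imV_def cxV_def complex_eq_iff field_simps exp_minus_times cd_cancel cd)
  then show ?thesis by blast
qed

lemma unitary_frame_model: "unitary_frame_chart UNIV G JJ model_frame"
proof unfold_locales
  show "unitary_frame UNIV G JJ model_frame"
    using smooth_on_model_frame model_frame_type model_frame_span model_frame_unitary
    by (simp add: unitary_frame_def)
qed (use almost_kaehler_model in auto)


section \<open>Connection forms of the model frame\<close>

lemma cdir_derivV_model_frame_simps:
  "cdir_derivV (model_frame 1) p w = 0"
  "cdir_derivV (model_frame 2) p w =
     w$1 *s vector [0, 0, - exp (- p$1) / sqrt 2, - \<i> * exp (p$1) / sqrt 2, 0, 0]"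
  "cdir_derivV (model_frame 3) p w =
     w$1 *s vector [0, 0, 0, 0, - exp (- p$1) * Complex 1 (- a') / sqrt (2 * c'), - \<i> * c' * exp (p$1) / sqrt (2 * c')]"
  unfolding vec_eq_iff forall_6 cdir_derivV_model_frame
  by (simp_all add: frame_const_def frame_minus_def frame_plus_def scaleR_conv_of_real[where 'a = complex])

text \<open>An equation between functions, so that it rewrites inside \<open>ext_bil\<close>, where
  the arguments are bound.\<close>

lemma model_koszul:
  "G p (christoffel_map G p x y) =
    (\<lambda>v. (metric_deriv G p x y v + metric_deriv G p y x v - metric_deriv G p v x y) / 2)"
proof
  fix v
  interpret unitary_frame_chart UNIV G JJ model_frame by (rule unitary_frame_model)
  show "G p (christoffel_map G p x y) v =
      (metric_deriv G p x y v + metric_deriv G p y x v - metric_deriv G p v x y) / 2"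
    using koszul[OF metric open_W, of p x y v] by simp
qed

text \<open>The Christoffel term contributes nothing on the diagonal. Derivatives of the metric
  along the frame vector Z drop out: the second and third Z have no s-component, and the first lies
  in the plane where the metric is constant. The derivative of the metric along w, paired with Z and
  its conjugate, is zero by \<open>c' * d' = 1 + a' * a'\<close>. Only the coordinate derivative of
  the frame remains; it gives i a' ds for the third vector, and zero for the second because its
  block is standard.\<close>

lemma conn_form_model:
  "conn_form G JJ model_frame j j p w = (if j = 3 then \<i> * a' * w$1 else 0)"
proof -
  interpret unitary_frame_chart UNIV G JJ model_frame by (rule unitary_frame_model)
  have "conn_form G JJ model_frame j j p w =
     ext_bil (G p) (cdir_derivV (model_frame j) p w) (cnjV (model_frame j p)) +
     (ext_bil (\<lambda>y v. (metric_deriv G p (reV w) y v + metric_deriv G p y (reV w) v - metric_deriv G p v (reV w) y) / 2)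
        (model_frame j p) (cnjV (model_frame j p)) +
      \<i> * ext_bil (\<lambda>y v. (metric_deriv G p (imV w) y v + metric_deriv G p y (imV w) v - metric_deriv G p v (imV w) y) / 2)
        (model_frame j p) (cnjV (model_frame j p)))" for j
    by (simp add: conn_form_eq levi_civita_cx_def ext_bil_left bilinear_g ext_bil_ext_bilV model_koszul)
  note expand = this
  have "\<forall>j. conn_form G JJ model_frame j j p w = (if j = 3 then \<i> * a' * w$1 else 0)"
    unfolding forall_3 expand cdir_derivV_model_frame_simps model_frame_simps metric_deriv_model
    using c_pos
    by (simp add: ext_bil_def model_g_def Let_def reV_def imV_def cnjV_def complex_eq_iff field_simps
        exp_minus_times cd_cancel cd)
  then show ?thesis by blast
qed

lemma ext_d1_trace_model:
  "ext_d1 (\<lambda>q w. \<Sum>i\<in>UNIV. conn_form G JJ model_frame i i q w) p u v = 0"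
  by (simp add: conn_form_model ext_d1_def)

end

section \<open>Restriction to open sets and descent to the quotient\<close>

lemma almost_kaehler_subset:
  assumes "almost_kaehler W g J" "V \<subseteq> W"
  shows "almost_kaehler V g J"
proof -
  note sub = smooth_on_subset[OF _ assms(2)]
  show ?thesis
    using assms sub
    unfolding almost_kaehler_def riemannian_metric_def almost_complex_def by (meson subsetD)
qed

lemma unitary_frame_subset:
  assumes "unitary_frame W g J z" "V \<subseteq> W"
  shows "unitary_frame V g J z"
  using assms smooth_on_subset[OF _ assms(2)] unfolding unitary_frame_def by (meson subsetD)

context nakamura_model
begin

text \<open>A deck map shifts s by r and rescales the torus coordinates by exp (-r) and exp r, which
  compensates the change of the exponentials in the coefficients.\<close>

lemma model_quotient: "almost_kaehler_quotient (deck P \<zeta>) G JJ"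
proof -
  have "G (F p) (D u) (D v) = G p u v \<and> JJ (F p) (D v) = D (JJ p v)"
    if deck: "F \<in> deck P \<zeta>" and deriv: "D = frechet_derivative F (at p)" for F p u v D
  proof -
    obtain m k x y where F: "F = deck_map P \<zeta> m k x y" using deck unfolding deck_def by blast
    define r where "r = of_int m * \<zeta>"
    have D: "D = (\<lambda>v. vector [v$1, v$2, exp (- r) * v$3, exp r * v$4, exp (- r) * v$5, exp r * v$6])"
      using frechet_derivative_at[OF deck_map_has_derivative] deriv by (simp add: F Let_def r_def)
    have F1: "F p $ 1 = p$1 + r" by (simp add: F deck_map_def Let_def r_def)
    have "G (F p) (D u) (D v) = G p u v"
      by (simp add: model_g_def Let_def F1 D exp_add exp_diff exp_minus field_simps)
    moreover have "JJ (F p) (D v) = D (JJ p v)"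
      unfolding vec_eq_iff forall_6
      by (simp add: model_J_def Let_def F1 D exp_add exp_diff exp_minus field_simps)
    ultimately show ?thesis by blast
  qed
  then show ?thesis
    using almost_kaehler_model by (simp add: almost_kaehler_quotient_def Let_def)
qed

text \<open>The model frame is defined on the whole cover, so its restriction to \<open>W\<close> is
  available for comparison with any local frame.\<close>

lemma model_ricci_coeff:
  fixes z :: "3 \<Rightarrow> 6 cvfield"
  assumes "open W" "unitary_frame W G JJ z" "p \<in> W"
  shows "ricci_coeff G JJ z p k l = 0"
proof (rule ricci_coeff_zero)
  have ak: "almost_kaehler W G JJ"
    using almost_kaehler_subset[OF almost_kaehler_model] by blast
  have "unitary_frame W G JJ model_frame"
    using unitary_frame_subset unitary_frame_chart.unitary_frame[OF unitary_frame_model] by blast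
  then show "unitary_frame_change W G JJ z model_frame"
    using ak assms by unfold_locales
qed (use assms ext_d1_trace_model in auto)

end

section \<open>Identification of the deformed structures with the model\<close>

lemma nak_omega_model_J:
  "nak_omega p u (model_J a c d a' c' d' p v) = model_g a c d a' c' d' p u v"
proof -
  have EF: "exp (- p$1) * exp (p$1) = 1" by (rule exp_minus_times)
  show ?thesis
    using EF by (simp add: nak_omega_def wedge_def coframe_def model_g_def model_J_def Let_def) algebra
qed

definition delta :: "real \<Rightarrow> real \<Rightarrow> real" where "delta x y = 1 - x\<^sup>2 - y\<^sup>2"

text \<open>On a plane where \<open>L = (-x, -y; -y, x)\<close>, so that \<open>det (I + L) = delta x y\<close>, and \<open>J\<close> is standard,
  \<open>(I + L) J (I + L)\<^sup>-\<^sup>1\<close> is the block with \<open>a = block_a x y\<close>,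
  \<open>c = block_c x y\<close>, \<open>d = block_c (-x) y\<close>.\<close>

definition block_a :: "real \<Rightarrow> real \<Rightarrow> real" where "block_a x y = - 2 * y / delta x y"
definition block_c :: "real \<Rightarrow> real \<Rightarrow> real" where "block_c x y = ((1 + x)\<^sup>2 + y\<^sup>2) / delta x y"

lemma block_c_pos:
  assumes "0 < delta x y"
  shows "0 < block_c x y"
proof -
  have "(1 + x)\<^sup>2 + y\<^sup>2 \<noteq> 0"
  proof
    assume "(1 + x)\<^sup>2 + y\<^sup>2 = 0"
    then have "x = - 1" "y = 0" by (simp_all add: sum_power2_eq_zero_iff)
    with assms show False by (simp add: delta_def)
  qed
  then have "0 < (1 + x)\<^sup>2 + y\<^sup>2" by (simp add: less_le)
  then show ?thesis using assms by (simp add: block_c_def)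
qed

text \<open>Conjugation by I + L preserves the determinant 1 of the standard block; in numerators
  this is the identity with \<delta>^2 + (2 y)^2.\<close>

lemma block_det:
  assumes "0 < delta x y"
  shows "block_c x y * block_c (- x) y = 1 + block_a x y * block_a x y"
proof -
  have "((1 + x)\<^sup>2 + y\<^sup>2) * ((1 - x)\<^sup>2 + y\<^sup>2) = delta x y * delta x y + (2 * y) * (2 * y)"
    by (simp add: delta_def power2_eq_square algebra_simps)
  moreover have "delta (- x) y = delta x y" by (simp add: delta_def)
  ultimately show ?thesis
    using assms by (simp add: block_c_def block_a_def) (simp add: add_divide_distrib)
qed

context
  fixes t :: "real^4"
  assumes t: "(norm t)\<^sup>2 < 1"
begin

text \<open>Both quantities are at least 1 - |t|^2, which is why the unit ball is a suitable
  parameter domain.\<close>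

lemma delta_pos: "0 < delta (t$1) (t$2)" "0 < delta (t$3) (t$4)"
proof -
  have "(norm t)\<^sup>2 = (t$1)\<^sup>2 + (t$2)\<^sup>2 + (t$3)\<^sup>2 + (t$4)\<^sup>2"
    unfolding power2_norm_eq_inner inner_vec_def sum_4 by (simp add: power2_eq_square)
  then show "0 < delta (t$1) (t$2)" "0 < delta (t$3) (t$4)"
    using t zero_le_power2[of "t$1"] zero_le_power2[of "t$2"] zero_le_power2[of "t$3"] zero_le_power2[of "t$4"]
    unfolding delta_def by linarith+
qed

lemma id_plus_L_eq:
  "id_plus_L t p v = (let E = exp (p$1); F = exp (- p$1) in
     vector [(1 - t$1) * v$1 - t$2 * v$2, (1 + t$1) * v$2 - t$2 * v$1, 2 * v$3, 2 * v$4,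
       (1 - t$3) * v$5 - t$4 * (F * (F * v$6)), (1 + t$3) * v$6 - t$4 * (E * (E * v$5))])"
  unfolding vec_eq_iff forall_6
  by (simp add: id_plus_L_def nak_L_def endo_on_frame_def sum_6 frame_def coframe_def Let_def axis_def
      algebra_simps exp_minus_times)

text \<open>Adjugate over determinant on the first and third planes; on E_3, E_4 the map I + L is
  multiplication by 2.\<close>

definition id_plus_L_inv :: "6 endo" where
  "id_plus_L_inv p v = (let E = exp (p$1); F = exp (- p$1); \<delta> = delta (t$1) (t$2); \<delta>' = delta (t$3) (t$4) in
     vector [((1 + t$1) * v$1 + t$2 * v$2) / \<delta>, ((1 - t$1) * v$2 + t$2 * v$1) / \<delta>, v$3 / 2, v$4 / 2,
       ((1 + t$3) * v$5 + t$4 * (F * (F * v$6))) / \<delta>', ((1 - t$3) * v$6 + t$4 * (E * (E * v$5))) / \<delta>'])"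

lemma id_plus_L_inverse: "id_plus_L t p (id_plus_L_inv p v) = v" "id_plus_L_inv p (id_plus_L t p v) = v"
  using delta_pos unfolding vec_eq_iff forall_6
  by (simp_all add: id_plus_L_eq id_plus_L_inv_def Let_def field_simps exp_minus_times)
     (simp_all add: delta_def power2_eq_square algebra_simps exp_minus_times)

lemma bij_id_plus_L: "bij (id_plus_L t p)"
  by (rule bij_betw_byWitness[where f' = "id_plus_L_inv p"]) (auto simp: id_plus_L_inverse)

lemma inv_id_plus_L: "inv (id_plus_L t p) = id_plus_L_inv p"
  by (rule inv_equality) (auto simp: id_plus_L_inverse)

lemma nak_J_eq:
  "nak_J p v = (let E = exp (p$1); F = exp (- p$1) in
     vector [- v$2, v$1, - (F * (F * v$4)), E * (E * v$3), - (F * (F * v$6)), E * (E * v$5)])"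
  unfolding vec_eq_iff forall_6
  by (simp add: nak_J_def endo_on_frame_def sum_6 frame_def coframe_def Let_def axis_def)

text \<open>On the middle plane I + L is scalar, so conjugation leaves the standard block there; the
  other two planes give the blocks described above.\<close>

lemma nak_Jt_eq:
  "nak_Jt t = model_J (block_a (t$1) (t$2)) (block_c (t$1) (t$2)) (block_c (- t$1) (t$2))
     (block_a (t$3) (t$4)) (block_c (t$3) (t$4)) (block_c (- t$3) (t$4))"
proof -
  have "delta (- x) y = delta x y" for x y by (simp add: delta_def)
  then show ?thesis
    using delta_pos unfolding fun_eq_iff vec_eq_iff forall_6
    by (simp add: nak_Jt_def inv_id_plus_L id_plus_L_eq nak_J_eq id_plus_L_inv_def model_J_def Let_def
        block_a_def block_c_def field_simps power2_eq_square exp_minus_times)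
qed

lemma nak_gt_eq:
  "nak_gt t = model_g (block_a (t$1) (t$2)) (block_c (t$1) (t$2)) (block_c (- t$1) (t$2))
     (block_a (t$3) (t$4)) (block_c (t$3) (t$4)) (block_c (- t$3) (t$4))"
  by (intro ext) (simp add: nak_gt_def nak_Jt_eq nak_omega_model_J)

lemma nakamura_model_t:
  "nakamura_model (block_a (t$1) (t$2)) (block_c (t$1) (t$2)) (block_c (- t$1) (t$2))
     (block_a (t$3) (t$4)) (block_c (t$3) (t$4)) (block_c (- t$3) (t$4))"
  by unfold_locales (simp_all add: block_c_pos block_det delta_pos)

end

theorem theorem5p9:
  fixes A :: "int^2^2" and P :: "real^2^2" and \<zeta> :: real
  assumes "nakamura_data A P \<zeta>"
  shows "\<exists>\<epsilon>>0. \<forall>t::real^4. (norm t)\<^sup>2 < \<epsilon> \<longrightarrow>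
           (\<forall>p. bij (id_plus_L t p)) \<and>
           almost_kaehler_quotient (deck P \<zeta>) (nak_gt t) (nak_Jt t) \<and>
           (\<forall>V (z :: 3 \<Rightarrow> 6 cvfield).
              local_unitary_frame (nak_pr P \<zeta>) (deck P \<zeta>) (nak_gt t) (nak_Jt t) V z \<longrightarrow>
              (\<forall>p\<in>nak_pr P \<zeta> -` V.
                 (\<forall>u v. ricci_form (nak_gt t) (nak_Jt t) z p u v = 0) \<and>
                 scal (nak_gt t) (nak_Jt t) z p = 0))"
proof (intro exI[of _ 1] conjI allI impI ballI)
  fix t :: "real^4" assume t: "(norm t)\<^sup>2 < 1"
  show "bij (id_plus_L t p)" for p by (rule bij_id_plus_L[OF t])
  show "almost_kaehler_quotient (deck P \<zeta>) (nak_gt t) (nak_Jt t)"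
    unfolding nak_gt_eq[OF t] nak_Jt_eq[OF t]
    by (rule nakamura_model.model_quotient[OF nakamura_model_t[OF t]])
  fix V and z :: "3 \<Rightarrow> 6 cvfield" and p
  assume z: "local_unitary_frame (nak_pr P \<zeta>) (deck P \<zeta>) (nak_gt t) (nak_Jt t) V z"
    and p: "p \<in> nak_pr P \<zeta> -` V"
  then have "open (nak_pr P \<zeta> -` V)" "unitary_frame (nak_pr P \<zeta> -` V) (nak_gt t) (nak_Jt t) z"
    by (simp_all add: local_unitary_frame_def quotient_open_def)
  then have "ricci_coeff (nak_gt t) (nak_Jt t) z p k l = 0" for k l
    unfolding nak_gt_eq[OF t] nak_Jt_eq[OF t]
    using p by (rule nakamura_model.model_ricci_coeff[OF nakamura_model_t[OF t]])
  then show "ricci_form (nak_gt t) (nak_Jt t) z p u v = 0" "scal (nak_gt t) (nak_Jt t) z p = 0" for u v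
    by (simp_all add: ricci_form_def scal_def)
qed simp

end
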